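(* Let $E\subset\mathbb{R}^2$ be the Blaschke–Santaló diagram for $\lambda(\Omega)$ and $T(\Omega)$ in dimension $d=1$, that is, the set of all points $(x(\Omega),y(\Omega))$ as $\Omega$ ranges over the open subsets of $\mathbb{R}$ with $0<|\Omega|<\infty$. Then, for $0<x\le1$, $(x,y)\in E$ if and only if $$x^{3/2}\le y\le x^{3/2}\Big(\big[x^{-1/2}\big]+\big(x^{-1/2}-\big[x^{-1/2}\big]\big)^3\Big).$$
   Context: $[s]$ denotes the integer part of $s$. For an open set $\Omega\subset\mathbb{R}$ with Lebesgue measure $0<|\Omega|<\infty$: $\lambda(\Omega)=\min\{\int_\Omega|u'|^2dx\,/\int_\Omega u^2dx : u\in H^1_0(\Omega),\ u\ne0\}$ is the first Dirichlet eigenvalue of $-\frac{d^2}{dx^2}$; $T(\Omega)=\int_\Omega w_\Omega\,dx$ is the torsional rigidity, where $w_\Omega\in H^1_0(\Omega)$ is the unique weak solution of $-w''=1$ in $\Omega$. With $B_1=\,]-1,1[$, $$x(\Omega)=\frac{|B_1|^{2}\lambda(B_1)}{|\Omega|^{2}\lambda(\Omega)},\qquad y(\Omega)=\frac{|B_1|^{3}\,T(\Omega)}{|\Omega|^{3}\,T(B_1)}.$$ The coordinates are normalised so that $x(\Omega)$ and $y(\Omega)$ lie in $[0,1]$.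
   Formalization: The right-hand side gets the extra condition that y = x^{3/2} only if x = 1, because for 0 < x < 1 the lower boundary points (x, x^{3/2}), such as (1/4, 1/8), satisfy the inequalities but are not in E. *)

theory Defs
  imports "HOL-Analysis.Analysis"
begin

definition test_functions :: "real set \<Rightarrow> (real \<Rightarrow> real) set" where
  "test_functions \<Omega> = {\<phi>. (\<forall>k x. (deriv ^^ k) \<phi> differentiable (at x)) \<and>
     compact (closure {x. \<phi> x \<noteq> 0}) \<and> closure {x. \<phi> x \<noteq> 0} \<subseteq> \<Omega>}"

text \<open>Elements of the spaces below are functions, not classes modulo null sets; their values
  outside \<open>\<Omega>\<close> are irrelevant, since all integrals are taken with respect to Lebesgue measure
  on \<open>\<Omega>\<close>.\<close>

definition L2 :: "real set \<Rightarrow> (real \<Rightarrow> real) set" where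
  "L2 \<Omega> = {u \<in> borel_measurable (lebesgue_on \<Omega>). integrable (lebesgue_on \<Omega>) (\<lambda>x. (u x)\<^sup>2)}"

definition is_weak_deriv :: "real set \<Rightarrow> (real \<Rightarrow> real) \<Rightarrow> (real \<Rightarrow> real) \<Rightarrow> bool" where
  "is_weak_deriv \<Omega> u g \<longleftrightarrow> (\<forall>\<phi>\<in>test_functions \<Omega>.
     (LINT x|lebesgue_on \<Omega>. u x * deriv \<phi> x) = - (LINT x|lebesgue_on \<Omega>. g x * \<phi> x))"

definition H1 :: "real set \<Rightarrow> (real \<Rightarrow> real) set" where
  "H1 \<Omega> = {u \<in> L2 \<Omega>. \<exists>g\<in>L2 \<Omega>. is_weak_deriv \<Omega> u g}"

text \<open>The weak derivative of an element of \<open>H1 \<Omega>\<close> is determined up to a null set of \<open>\<Omega>\<close>, so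
  the choice does not affect any integral.\<close>

definition weak_deriv :: "real set \<Rightarrow> (real \<Rightarrow> real) \<Rightarrow> real \<Rightarrow> real" where
  "weak_deriv \<Omega> u = (SOME g. g \<in> L2 \<Omega> \<and> is_weak_deriv \<Omega> u g)"

text \<open>\<open>H\<^sup>1\<^sub>0(\<Omega>)\<close>: the closure of the test functions in the norm of \<open>H\<^sup>1(\<Omega>)\<close>.\<close>

definition H10 :: "real set \<Rightarrow> (real \<Rightarrow> real) set" where
  "H10 \<Omega> = {u \<in> H1 \<Omega>. \<exists>\<phi>. (\<forall>n. \<phi> n \<in> test_functions \<Omega>) \<and>
     (\<lambda>n. (LINT x|lebesgue_on \<Omega>. (\<phi> n x - u x)\<^sup>2)
        + (LINT x|lebesgue_on \<Omega>. (deriv (\<phi> n) x - weak_deriv \<Omega> u x)\<^sup>2)) \<longlonglongrightarrow> 0}"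

text \<open>\<open>LEAST\<close> is the minimum of the Rayleigh quotient (not merely its infimum).\<close>

definition dirichlet_eigenvalue :: "real set \<Rightarrow> real" where
  "dirichlet_eigenvalue \<Omega> = (LEAST l. \<exists>u\<in>H10 \<Omega>. \<not> (AE x in lebesgue_on \<Omega>. u x = 0) \<and>
     l = (LINT x|lebesgue_on \<Omega>. (weak_deriv \<Omega> u x)\<^sup>2) / (LINT x|lebesgue_on \<Omega>. (u x)\<^sup>2))"

text \<open>The weak solution of \<open>- w'' = 1\<close> in \<open>H\<^sup>1\<^sub>0(\<Omega>)\<close>, again unique up to a null set.\<close>

definition torsion_function :: "real set \<Rightarrow> real \<Rightarrow> real" where
  "torsion_function \<Omega> = (SOME w. w \<in> H10 \<Omega> \<and> (\<forall>v\<in>H10 \<Omega>.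
     (LINT x|lebesgue_on \<Omega>. weak_deriv \<Omega> w x * weak_deriv \<Omega> v x) = (LINT x|lebesgue_on \<Omega>. v x)))"

definition torsional_rigidity :: "real set \<Rightarrow> real" where
  "torsional_rigidity \<Omega> = (LINT x|lebesgue_on \<Omega>. torsion_function \<Omega> x)"

abbreviation B1 :: "real set" where
  "B1 \<equiv> {-1<..<1}"

definition x_coord :: "real set \<Rightarrow> real" where
  "x_coord \<Omega> = ((measure lebesgue B1)\<^sup>2 * dirichlet_eigenvalue B1) /
     ((measure lebesgue \<Omega>)\<^sup>2 * dirichlet_eigenvalue \<Omega>)"

definition y_coord :: "real set \<Rightarrow> real" where
  "y_coord \<Omega> = ((measure lebesgue B1) ^ 3 * torsional_rigidity \<Omega>) /
     ((measure lebesgue \<Omega>) ^ 3 * torsional_rigidity B1)"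

text \<open>No closure is taken. Consequently the points \<open>(x, x powr (3/2))\<close> with \<open>0 < x < 1\<close> do not
  belong to the diagram: if \<open>\<Omega>\<close> has component lengths \<open>l\<^sub>i\<close> of sum 1 and maximum \<open>l < 1\<close>, then
  \<open>x = l\<^sup>2\<close>, \<open>y = (\<Sum>i. l\<^sub>i ^ 3)\<close>, and the components other than a longest one contribute a
  strictly positive amount to \<open>y\<close>.\<close>

definition blaschke_santalo_diagram :: "(real \<times> real) set" where
  "blaschke_santalo_diagram = {(x_coord \<Omega>, y_coord \<Omega>) | \<Omega>.
     open \<Omega> \<and> 0 < emeasure lebesgue \<Omega> \<and> emeasure lebesgue \<Omega> < \<infinity>}"

end

theory Submission
  imports Defs
begin

text \<open>If the components of \<open>\<Omega>\<close> have lengths \<open>l\<^sub>i\<close> and \<open>L\<close> is the largest of them, then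
  \<open>\<lambda>(\<Omega>) = \<pi>\<^sup>2 / L\<^sup>2\<close> and \<open>T(\<Omega>) = (\<Sum>i. l\<^sub>i\<^sup>3) / 12\<close>, so with \<open>r = L / |\<Omega>|\<close> the coordinates are
  \<open>x = r\<^sup>2\<close> and \<open>y = \<Sum>i. (l\<^sub>i / |\<Omega>|)\<^sup>3\<close>, and the bounds on \<open>y\<close> are those for a sum of cubes of numbers
  in \<open>[0, r]\<close> with sum 1. The explicit functions (a sine on a longest component, a parabola on every
  component) lie in \<open>H\<^sup>1\<^sub>0\<close> because a nonnegative \<open>u\<close> that is smooth in \<open>\<Omega>\<close> and has compact
  superlevel sets is the limit of the test functions \<open>u exp (- 1 / (n u - 1))\<close> (\<open>0\<close> where \<open>n u \<le> 1\<close>).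
  The integral identities for test functions come from differentiating one compactly supported
  function on the whole line, which avoids summation over the components.\<close>

subsection \<open>Smooth functions\<close>

text \<open>An open set of finite measure may be unbounded and have infinitely many components,
  while weak derivatives and the torsion function are arbitrary choices. What helps is one
  continuous function on the line that is positive exactly on \<Omega> and has compact superlevel
  sets; the parabolas provide it. Besides solving the torsion problem, it yields the cut-offs for
  the fundamental lemma of the calculus of variations, its maximum detects a longest component, and
  its superlevel sets reduce sums to finitely many components. The truncations converge with their
  derivatives because t exp (- 1 / (n t - 1)) has derivative (1 + r + r^2) exp (- r), r = 1 / (n t -
  1), bounded independently of n. The upper bound is superadditivity: floor s + (s - floor s)^3
  grows by at least t^3 when s grows by t in [0, 1]. Conversely, for r < 1, intervals of lengths r,
  t, t, ... and a shorter last one fill length 1; at t = r their cubes sum to the upper bound, for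
  small t to nearly r^3, and the sum is continuous in t. The value r^3 itself requires r = 1, as a
  further component adds a positive cube.\<close>

fun Ck :: "nat \<Rightarrow> real set \<Rightarrow> (real \<Rightarrow> real) \<Rightarrow> bool" where
  "Ck 0 S f \<longleftrightarrow> True"
| "Ck (Suc n) S f \<longleftrightarrow> (\<forall>x\<in>S. f differentiable at x) \<and> Ck n S (deriv f)"

text \<open>The recursion peels off one derivative at a time, which suits induction with the
  function arbitrary; this form matches the iterated derivatives in \<open>test_functions\<close>.
  Smoothness on \<open>S\<close> is \<open>Ck n S f\<close> for all \<open>n\<close>.\<close>

lemma Ck_iff: "Ck n S f \<longleftrightarrow> (\<forall>k<n. \<forall>x\<in>S. (deriv ^^ k) f differentiable at x)"
proof (induction n arbitrary: f)
  case (Suc n)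
  have "(\<forall>k<Suc n. P k) \<longleftrightarrow> P 0 \<and> (\<forall>k<n. P (Suc k))" for P :: "nat \<Rightarrow> bool"
    using less_Suc_eq_0_disj by auto
  from this[of "\<lambda>k. \<forall>x\<in>S. (deriv ^^ k) f differentiable at x"] show ?case
    using Suc by (simp add: funpow_Suc_right del: funpow.simps(2))
qed simp

lemma Ck_SucD: "Ck (Suc n) S f \<Longrightarrow> Ck n S f"
  by (simp add: Ck_iff)

lemma Ck_Un: "Ck n S f \<Longrightarrow> Ck n T f \<Longrightarrow> Ck n (S \<union> T) f"
  by (auto simp: Ck_iff)

lemma Ck_cong:
  assumes "open S" "\<And>x. x \<in> S \<Longrightarrow> f x = g x" "Ck n S f"
  shows "Ck n S g"
  using assms(2,3)
proof (induction n arbitrary: f g)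
  case (Suc n)
  have ev: "\<forall>\<^sub>F y in nhds x. f y = g y" if "x \<in> S" for x
    using assms(1) Suc.prems(1) that eventually_nhds by blast
  have "g differentiable at x" if "x \<in> S" for x
  proof -
    have "(f has_real_derivative deriv f x) (at x)"
      using Suc.prems(2) that by (simp add: DERIV_deriv_iff_real_differentiable)
    then have "(g has_real_derivative deriv f x) (at x)"
      by (rule has_field_derivative_transform_within_open[OF _ assms(1) that]) (rule Suc.prems(1))
    then show ?thesis by (auto simp: real_differentiable_def)
  qed
  moreover have "deriv f x = deriv g x" if "x \<in> S" for x
    using ev[OF that] by (rule deriv_cong_ev) simp
  ultimately show ?case using Suc.IH[of "deriv f" "deriv g"] Suc.prems(2) by simp
qed simp

lemma Ck_SucI:
  assumes "open S" "\<And>x. x \<in> S \<Longrightarrow> (f has_real_derivative g x) (at x)" "Ck n S g"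
  shows "Ck (Suc n) S f"
proof -
  have "g x = deriv f x" if "x \<in> S" for x
    using assms(2)[OF that] DERIV_imp_deriv by force
  then show ?thesis
    using assms Ck_cong[of S g "deriv f" n] by (auto simp: real_differentiable_def)
qed

lemma Ck_DERIV: "Ck (Suc n) S f \<Longrightarrow> x \<in> S \<Longrightarrow> (f has_real_derivative deriv f x) (at x)"
  by (simp add: DERIV_deriv_iff_real_differentiable)

lemma Ck_const [simp]: "Ck n S (\<lambda>x. c)"
  by (induction n arbitrary: c) auto

lemma Ck_id [simp]: "open S \<Longrightarrow> Ck n S (\<lambda>x. x)"
  by (cases n) (auto intro!: Ck_SucI derivative_eq_intros simp del: Ck.simps(2))

lemma Ck_add:
  assumes "open S" "Ck n S f" "Ck n S g"
  shows "Ck n S (\<lambda>x. f x + g x)"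
  using assms(2,3)
proof (induction n arbitrary: f g)
  case (Suc n)
  show ?case
    by (rule Ck_SucI[OF assms(1) DERIV_add[OF Ck_DERIV[OF Suc.prems(1)] Ck_DERIV[OF Suc.prems(2)]]])
      (use Suc in auto)
qed simp

lemma Ck_mult:
  assumes "open S" "Ck n S f" "Ck n S g"
  shows "Ck n S (\<lambda>x. f x * g x)"
  using assms(2,3)
proof (induction n arbitrary: f g)
  case (Suc n)
  show ?case
    by (rule Ck_SucI[OF assms(1) DERIV_mult'[OF Ck_DERIV[OF Suc.prems(1)] Ck_DERIV[OF Suc.prems(2)]]])
      (auto intro!: Ck_add[OF assms(1)] Suc.IH Ck_SucD[OF Suc.prems(1)] Ck_SucD[OF Suc.prems(2)]
        simp: Suc.prems[simplified])
qed simp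

lemma Ck_compose:
  assumes "open S" "\<And>x. x \<in> S \<Longrightarrow> g x \<in> T" "Ck n T f" "Ck n S g"
  shows "Ck n S (\<lambda>x. f (g x))"
  using assms(3,4)
proof (induction n arbitrary: f)
  case (Suc n)
  show ?case
    by (rule Ck_SucI[OF assms(1) DERIV_chain2[OF Ck_DERIV[OF Suc.prems(1)] Ck_DERIV[OF Suc.prems(2)]]])
      (use assms Suc Ck_SucD[OF Suc.prems(2)] in \<open>auto intro!: Ck_mult\<close>)
qed simp

lemma Ck_sin_cos: "open S \<Longrightarrow> Ck n S sin \<and> Ck n S cos"
proof (induction n)
  case (Suc n)
  have "Ck n S (\<lambda>x. (-1) * sin x)" using Suc by (intro Ck_mult) auto
  with Suc show ?case
    by (auto intro!: Ck_SucI derivative_eq_intros simp del: Ck.simps)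
qed simp

section \<open>The flat function exp (- 1 / x)\<close>

text \<open>For \<open>p = 1\<close> this is the classical smooth function that is flat at 0.
  Polynomials in 1 / x are carried along because the family is then closed under differentiation, so
  smoothness is an induction over one derivative formula.\<close>

definition flat_fun :: "real poly \<Rightarrow> real \<Rightarrow> real" where
  "flat_fun p x = (if x > 0 then poly p (1 / x) * exp (- 1 / x) else 0)"

lemma poly_exp_tendsto_0: "((\<lambda>t. poly p t * exp (- t)) \<longlongrightarrow> 0) (at_top :: real filter)"
proof -
  have "((\<lambda>t. coeff p i * (t ^ i / exp t)) \<longlongrightarrow> coeff p i * 0) (at_top :: real filter)" for i
    by (intro tendsto_mult tendsto_const tendsto_power_div_exp_0)
  then have "((\<lambda>t. \<Sum>i\<le>degree p. coeff p i * (t ^ i / exp t)) \<longlongrightarrow> (\<Sum>i\<le>degree p. 0)) (at_top :: real filter)"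
    by (intro tendsto_sum) simp
  then show ?thesis
    by (simp add: poly_altdef exp_minus sum_distrib_right divide_inverse mult.assoc)
qed

text \<open>The polynomial comes from \<open>d/dx = - t\<^sup>2 d/dt\<close> with \<open>t = 1 / x\<close>.\<close>

lemma flat_fun_DERIV:
  "(flat_fun p has_real_derivative flat_fun ([:0, 0, 1:] * (p - pderiv p)) x) (at x)"
proof -
  consider "x > 0" | "x < 0" | "x = 0" by linarith
  then show ?thesis
  proof cases
    case 1
    have "((\<lambda>x. poly p (1 / x) * exp (- 1 / x)) has_real_derivative
        flat_fun ([:0, 0, 1:] * (p - pderiv p)) x) (at x)"
      using 1 by (auto intro!: derivative_eq_intros simp: flat_fun_def field_simps power2_eq_square)
    then show ?thesis
      by (rule has_field_derivative_transform_within_open[where S = "{0<..}"])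
        (use 1 in \<open>auto simp: flat_fun_def\<close>)
  next
    case 2
    have "((\<lambda>x. 0) has_real_derivative 0) (at x)" by simp
    then have "(flat_fun p has_real_derivative 0) (at x)"
      by (rule has_field_derivative_transform_within_open[where S = "{..<0}"])
        (use 2 in \<open>auto simp: flat_fun_def\<close>)
    with 2 show ?thesis by (simp add: flat_fun_def)
  next
    case 3
    \<comment> \<open>The difference quotient at 0 has an extra factor 1 / h, which is absorbed by
      raising the degree of the polynomial by one.\<close>
    have "((\<lambda>h. poly (pCons 0 p) (inverse h) * exp (- inverse h)) \<longlongrightarrow> 0) (at_right 0)"
      by (rule filterlim_compose[OF poly_exp_tendsto_0 filterlim_inverse_at_top_right])
    then have "((\<lambda>h. (flat_fun p (0 + h) - flat_fun p 0) / h) \<longlongrightarrow> 0) (at_right 0)"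
      by (rule tendsto_cong[THEN iffD1, rotated])
        (auto simp: flat_fun_def eventually_at_filter field_simps)
    moreover have "((\<lambda>h. (flat_fun p (0 + h) - flat_fun p 0) / h) \<longlongrightarrow> 0) (at_left 0)"
      by (rule tendsto_eventually) (auto simp: flat_fun_def eventually_at_filter)
    ultimately have "((\<lambda>h. (flat_fun p (0 + h) - flat_fun p 0) / h) \<longlongrightarrow> 0) (at 0)"
      by (rule filterlim_split_at[rotated])
    then show ?thesis using 3 by (simp add: DERIV_def flat_fun_def)
  qed
qed

lemma Ck_flat_fun: "Ck n UNIV (flat_fun p)"
  by (induction n arbitrary: p) (auto intro!: Ck_SucI[OF _ flat_fun_DERIV] simp del: Ck.simps(2))

lemma flat_fun_tendsto: "(flat_fun p \<longlongrightarrow> poly p 0) at_top"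
proof -
  have inv: "((\<lambda>x::real. 1 / x) \<longlongrightarrow> 0) at_top"
    by (intro tendsto_divide_0[OF tendsto_const] filterlim_at_top_imp_at_infinity filterlim_ident)
  have "((\<lambda>x::real. poly p (1 / x) * exp (- (1 / x))) \<longlongrightarrow> poly p 0 * exp (- 0)) at_top"
    by (intro tendsto_mult tendsto_poly tendsto_exp tendsto_minus inv)
  moreover have "\<forall>\<^sub>F x in at_top. poly p (1 / x) * exp (- (1 / x)) = flat_fun p x"
    using eventually_gt_at_top[of 0] by eventually_elim (simp add: flat_fun_def)
  ultimately show ?thesis
    by (simp add: Lim_transform_eventually)
qed

text \<open>The argument tends to infinity, where only the constant coefficient of \<open>p\<close>
  survives. With constant coefficient 1 these are cut-offs that tend to 1 at every point where a
  nonnegative function is positive.\<close>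

lemma flat_fun_scaled_tendsto:
  assumes "t > 0"
  shows "(\<lambda>n. flat_fun p (real (Suc n) * t - 1)) \<longlonglongrightarrow> poly p 0"
proof -
  have "filterlim (\<lambda>n. real (Suc n)) at_top sequentially"
    using filterlim_real_sequentially by (subst filterlim_sequentially_Suc)
  then have "filterlim (\<lambda>n. -1 + t * real (Suc n)) at_top sequentially"
    by (intro filterlim_tendsto_add_at_top[OF tendsto_const]
        filterlim_tendsto_pos_mult_at_top[OF tendsto_const assms])
  then have "(\<lambda>n. flat_fun p (-1 + t * real (Suc n))) \<longlonglongrightarrow> poly p 0"
    by (rule filterlim_compose[OF flat_fun_tendsto])
  then show ?thesis by (simp add: algebra_simps)
qed

lemma Ck_flat_fun_affine: "Ck k UNIV (\<lambda>t. flat_fun p (a * t - b))"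
proof (rule Ck_compose[where T = UNIV, OF _ _ Ck_flat_fun])
  have "Ck k UNIV (\<lambda>t. a * t + - b)" by (intro Ck_add Ck_mult) simp_all
  then show "Ck k UNIV (\<lambda>t. a * t - b)" by simp
qed simp_all

lemma flat_fun_bounds: "0 \<le> flat_fun [:1:] x" "flat_fun [:1:] x \<le> 1"
  by (auto simp: flat_fun_def)

subsection \<open>Components of an open set of finite measure\<close>

lemma Ck_local:
  assumes "\<And>x. x \<in> S \<Longrightarrow> \<exists>T. x \<in> T \<and> Ck n T f"
  shows "Ck n S f"
  using assms unfolding Ck_iff by blast

definition lft :: "real set \<Rightarrow> real \<Rightarrow> real" where
  "lft \<Omega> x = Inf (connected_component_set \<Omega> x)"

definition rgt :: "real set \<Rightarrow> real \<Rightarrow> real" where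
  "rgt \<Omega> x = Sup (connected_component_set \<Omega> x)"

text \<open>On a component this is the solution of - w'' = 1 that vanishes at both endpoints. The
  value 0 off \<Omega> makes it continuous on the whole line.\<close>

definition torsion_profile :: "real set \<Rightarrow> real \<Rightarrow> real" where
  "torsion_profile \<Omega> x = (if x \<in> \<Omega> then (x - lft \<Omega> x) * (rgt \<Omega> x - x) / 2 else 0)"

locale open_finite =
  fixes \<Omega> :: "real set"
  assumes open_Omega: "open \<Omega>" and lmeas_Omega: "\<Omega> \<in> lmeasurable"
begin

abbreviation "m \<equiv> measure lebesgue \<Omega>"

lemma Icc_subset_le:
  assumes "{y..z} \<subseteq> \<Omega>"
  shows "z - y \<le> m"
proof (cases "y \<le> z")
  case True
  have "measure lebesgue {y..z} \<le> m"
    by (rule measure_mono_fmeasurable[OF assms]) (use lmeas_Omega in auto)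
  with True show ?thesis by simp
next
  case False
  then show ?thesis using measure_nonneg[of lebesgue \<Omega>] by linarith
qed

text \<open>An interval inside \<Omega> is no longer than the measure of \<Omega>, so a component is
  bounded; being open and connected it is the open interval between its infimum and
  supremum.\<close>

lemma component_eq:
  assumes "x \<in> \<Omega>"
  shows "connected_component_set \<Omega> x = {lft \<Omega> x<..<rgt \<Omega> x}"
proof -
  define C where "C = connected_component_set \<Omega> x"
  have C: "open C" "connected C" "x \<in> C" "C \<subseteq> \<Omega>"
    using assms open_Omega open_connected_component connected_component_subset[of \<Omega> x]
    by (simp_all add: C_def)
  have Icc: "{y..z} \<subseteq> C" if "y \<in> C" "z \<in> C" for y z
    using mem_is_interval_1_I[OF C(2)[folded is_interval_connected_1] that] by auto
  have "\<bar>y - x\<bar> \<le> m" if "y \<in> C" for y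
    using Icc_subset_le[of x y] Icc_subset_le[of y x] Icc[OF that C(3)] Icc[OF C(3) that] C(4)
    by (auto simp: abs_le_iff)
  then have bd: "bounded C"
    by (auto intro!: boundedI[of _ "\<bar>x\<bar> + m"])
      (smt (verit))
  note bnd = bounded_imp_bdd_above[OF bd] bounded_imp_bdd_below[OF bd]
  have "Inf C < y \<and> y < Sup C" if y: "y \<in> C" for y
  proof -
    obtain e where e: "e > 0" "ball y e \<subseteq> C" using C(1) y openE by blast
    have "y - e/2 \<in> C" "y + e/2 \<in> C" using e by (auto simp: dist_real_def subset_iff)
    then have "Inf C \<le> y - e/2" "y + e/2 \<le> Sup C"
      using bnd by (auto intro: cInf_lower cSup_upper)
    with e show ?thesis by auto
  qed
  moreover have "y \<in> C" if y: "Inf C < y" "y < Sup C" for y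
  proof -
    obtain c where "c \<in> C" "c < y" using y C(3) bnd cInf_less_iff[of C y] by blast
    moreover obtain d where "d \<in> C" "y < d" using y C(3) bnd less_cSup_iff[of C y] by blast
    ultimately show ?thesis using Icc[of c d] by auto
  qed
  ultimately show ?thesis by (auto simp: C_def lft_def rgt_def)
qed

lemma component_bounds:
  assumes "x \<in> \<Omega>"
  shows "lft \<Omega> x < x" "x < rgt \<Omega> x" "{lft \<Omega> x<..<rgt \<Omega> x} \<subseteq> \<Omega>"
  using component_eq[OF assms] connected_component_refl[OF assms] connected_component_subset[of \<Omega> x]
  by auto

lemma component_maximal:
  assumes "connected T" "T \<subseteq> \<Omega>" "x \<in> T"
  shows "T \<subseteq> {lft \<Omega> x<..<rgt \<Omega> x}"
  using connected_component_maximal[OF assms(3,1,2)] component_eq[of x] assms by auto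

lemma endpoints_notin:
  assumes "x \<in> \<Omega>"
  shows "lft \<Omega> x \<notin> \<Omega>" "rgt \<Omega> x \<notin> \<Omega>"
proof -
  have *: "z \<notin> \<Omega>" if z: "z = lft \<Omega> x \<or> z = rgt \<Omega> x" for z
  proof
    assume "z \<in> \<Omega>"
    let ?U = "{min x z..max x z}"
    have "?U \<subseteq> insert z {lft \<Omega> x<..<rgt \<Omega> x}"
      using z component_bounds[OF assms] by auto
    then have "?U \<subseteq> \<Omega>" using \<open>z \<in> \<Omega>\<close> component_bounds[OF assms] by blast
    then have "?U \<subseteq> {lft \<Omega> x<..<rgt \<Omega> x}"
      by (intro component_maximal) auto
    moreover have "z \<in> ?U" by auto
    ultimately have "z \<in> {lft \<Omega> x<..<rgt \<Omega> x}" by blast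
    then show False using z by auto
  qed
  show "lft \<Omega> x \<notin> \<Omega>" "rgt \<Omega> x \<notin> \<Omega>" using * by auto
qed

text \<open>An interval inside \<Omega> whose endpoints are missing from \<Omega> cannot be
  enlarged. This is how components of concrete sets are recognised.\<close>

lemma component_unique:
  assumes "a < x" "x < b" "{a<..<b} \<subseteq> \<Omega>" "a \<notin> \<Omega>" "b \<notin> \<Omega>"
  shows "lft \<Omega> x = a" "rgt \<Omega> x = b"
proof -
  have x: "x \<in> \<Omega>" using assms by auto
  have "{a<..<b} \<subseteq> {lft \<Omega> x<..<rgt \<Omega> x}"
    using assms by (intro component_maximal) auto
  then have "lft \<Omega> x \<le> a" "b \<le> rgt \<Omega> x"
    using assms(1,2) by (simp_all add: greaterThanLessThan_subseteq_greaterThanLessThan)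
  then show "lft \<Omega> x = a" "rgt \<Omega> x = b"
    using component_bounds[OF x] assms by force+
qed

lemma component_same:
  assumes "x \<in> \<Omega>" "lft \<Omega> x < y" "y < rgt \<Omega> x"
  shows "lft \<Omega> y = lft \<Omega> x" "rgt \<Omega> y = rgt \<Omega> x"
  using component_unique[of "lft \<Omega> x" y "rgt \<Omega> x"] assms component_bounds endpoints_notin by auto

lemma component_length_le:
  assumes "x \<in> \<Omega>"
  shows "rgt \<Omega> x - lft \<Omega> x \<le> m"
proof -
  have "measure lebesgue {lft \<Omega> x<..<rgt \<Omega> x} \<le> m"
    by (rule measure_mono_fmeasurable) (use lmeas_Omega component_bounds[OF assms] in auto)
  with component_bounds[OF assms] show ?thesis by simp
qed

lemma torsion_profile_component:
  assumes "x \<in> \<Omega>" "y \<in> {lft \<Omega> x<..<rgt \<Omega> x}"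
  shows "torsion_profile \<Omega> y = (y - lft \<Omega> x) * (rgt \<Omega> x - y) / 2"
  using component_same[OF assms(1), of y] component_bounds(3)[OF assms(1)] assms(2)
  by (auto simp: torsion_profile_def subset_iff)

lemma torsion_profile_pos: "x \<in> \<Omega> \<Longrightarrow> 0 < torsion_profile \<Omega> x"
  using component_bounds[of x] by (auto simp: torsion_profile_def)

lemma torsion_profile_nonneg: "0 \<le> torsion_profile \<Omega> x"
  using torsion_profile_pos[of x] by (auto simp: torsion_profile_def)

text \<open>A point off \<Omega> lies beyond one endpoint of the component of \<open>y\<close>, so
  one factor of the parabola is at most the distance and the other at most \<open>m\<close>. The
  bound gives continuity at the boundary and keeps superlevel sets away from the complement.\<close>

lemma torsion_profile_le_dist:
  assumes "x \<notin> \<Omega>"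
  shows "torsion_profile \<Omega> y \<le> m * \<bar>y - x\<bar>"
proof (cases "y \<in> \<Omega>")
  case True
  note b = component_bounds[OF True] component_length_le[OF True]
  have "x \<le> lft \<Omega> y \<or> rgt \<Omega> y \<le> x" using assms b(3) by force
  then have "y - lft \<Omega> y \<le> \<bar>y - x\<bar> \<or> rgt \<Omega> y - y \<le> \<bar>y - x\<bar>" by linarith
  then have "(y - lft \<Omega> y) * (rgt \<Omega> y - y) \<le> m * \<bar>y - x\<bar>"
  proof
    assume "y - lft \<Omega> y \<le> \<bar>y - x\<bar>"
    then have "(y - lft \<Omega> y) * (rgt \<Omega> y - y) \<le> \<bar>y - x\<bar> * m"
      using b by (intro mult_mono) auto
    then show ?thesis by (simp add: mult.commute)
  next
    assume "rgt \<Omega> y - y \<le> \<bar>y - x\<bar>"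
    then show ?thesis using b by (intro mult_mono) auto
  qed
  then show ?thesis using True b(1,2)
    by (simp add: torsion_profile_def) (smt (verit) mult_pos_pos field_sum_of_halves)
qed (simp add: torsion_profile_def)

lemma Ck_torsion_profile: "Ck n \<Omega> (torsion_profile \<Omega>)"
proof (rule Ck_local)
  fix x assume x: "x \<in> \<Omega>"
  let ?C = "{lft \<Omega> x<..<rgt \<Omega> x}"
  have "Ck n ?C (\<lambda>y. (y + - lft \<Omega> x) * (rgt \<Omega> x + (-1) * y) * (1/2))"
    by (intro Ck_mult Ck_add) auto
  moreover have "(y + - lft \<Omega> x) * (rgt \<Omega> x + (-1) * y) * (1/2) = torsion_profile \<Omega> y"
    if "y \<in> ?C" for y
    unfolding torsion_profile_component[OF x that] by (simp add: field_simps)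
  ultimately have "Ck n ?C (torsion_profile \<Omega>)"
    by (rule Ck_cong[OF open_greaterThanLessThan, rotated])
  moreover have "x \<in> ?C" using component_bounds[OF x] by simp
  ultimately show "\<exists>T. x \<in> T \<and> Ck n T (torsion_profile \<Omega>)" by blast
qed

lemma torsion_profile_DERIV:
  assumes x: "x \<in> \<Omega>"
  shows "(torsion_profile \<Omega> has_real_derivative (lft \<Omega> x + rgt \<Omega> x) / 2 - x) (at x)"
proof -
  let ?C = "{lft \<Omega> x<..<rgt \<Omega> x}"
  have "((\<lambda>y. (y - lft \<Omega> x) * (rgt \<Omega> x - y) / 2) has_real_derivative (lft \<Omega> x + rgt \<Omega> x) / 2 - x) (at x)"
    by (auto intro!: derivative_eq_intros simp: field_simps)
  then show ?thesis
    by (rule has_field_derivative_transform_within_open[where S = ?C])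
      (use component_bounds[OF x] in \<open>auto simp: torsion_profile_component[OF x]\<close>)
qed

lemma continuous_torsion_profile: "continuous_on UNIV (torsion_profile \<Omega>)"
proof -
  have "isCont (torsion_profile \<Omega>) x" for x
  proof (cases "x \<in> \<Omega>")
    case True
    then show ?thesis using torsion_profile_DERIV DERIV_isCont by blast
  next
    case False
    have "((\<lambda>y. m * \<bar>y - x\<bar>) \<longlongrightarrow> m * \<bar>x - x\<bar>) (at x)"
      by (intro tendsto_intros)
    then have "(torsion_profile \<Omega> \<longlongrightarrow> 0) (at x)"
      using torsion_profile_le_dist[OF False] torsion_profile_nonneg
      by (intro tendsto_sandwich[of "\<lambda>_. 0" "torsion_profile \<Omega>" _ "\<lambda>y. m * \<bar>y - x\<bar>"]) auto
    with False show ?thesis by (simp add: isCont_def torsion_profile_def)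
  qed
  then show ?thesis by (simp add: continuous_at_imp_continuous_on)
qed

text \<open>Boundedness is the point, since \<Omega> itself may be unbounded. A point where the
  profile is at least \<epsilon> is the centre of an interval of length 2 \<epsilon> /
  \<open>m\<close> inside \<Omega>; far out there is no room for it, because the part of \<Omega>
  outside [- n, n] has measure tending to 0.\<close>

lemma compact_torsion_profile_ge:
  assumes "\<epsilon> > 0"
  shows "compact {x. \<epsilon> \<le> torsion_profile \<Omega> x}"
proof (cases "\<Omega> = {}")
  case True
  with assms show ?thesis by (simp add: torsion_profile_def)
next
  case False
  then obtain z where "z \<in> \<Omega>" by auto
  then have "m > 0" using component_length_le[of z] component_bounds[of z] by linarith
  define \<delta> where "\<delta> = \<epsilon> / m"
  have \<delta>: "\<delta> > 0" using assms \<open>m > 0\<close> by (simp add: \<delta>_def)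
  have ball: "{x - \<delta><..<x + \<delta>} \<subseteq> \<Omega>" if "\<epsilon> \<le> torsion_profile \<Omega> x" for x
  proof (rule ccontr)
    assume "\<not> ?thesis"
    then obtain y where y: "y \<notin> \<Omega>" "\<bar>x - y\<bar> < \<delta>"
      unfolding subset_iff abs_less_iff by fastforce
    have "m * \<bar>x - y\<bar> < \<epsilon>" using y(2) \<open>m > 0\<close> by (simp add: \<delta>_def field_simps)
    with torsion_profile_le_dist[OF y(1), of x] that show False by simp
  qed
  interpret finite_measure "lebesgue_on \<Omega>" using lmeas_Omega by (rule finite_measure_lebesgue_on)
  let ?A = "\<lambda>n::nat. \<Omega> - {- real n..real n}"
  have Om: "\<Omega> \<in> sets lebesgue" using lmeas_Omega by auto
  have sets: "?A n \<in> sets (lebesgue_on \<Omega>)" for n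
    using Om by (auto simp: sets_restrict_space_iff)
  have lim: "(\<lambda>n. measure (lebesgue_on \<Omega>) (?A n)) \<longlonglongrightarrow> measure (lebesgue_on \<Omega>) (\<Inter>n. ?A n)"
    by (rule finite_Lim_measure_decseq) (use sets in \<open>auto simp: decseq_def\<close>)
  have Inter: "(\<Inter>n. ?A n) = {}"
  proof -
    have "x \<notin> (\<Inter>n. ?A n)" for x
    proof -
      obtain n where "\<bar>x\<bar> \<le> real n" using real_arch_simple by blast
      then have "x \<notin> ?A n" by auto
      then show ?thesis by blast
    qed
    then show ?thesis by blast
  qed
  have "(\<lambda>n. measure (lebesgue_on \<Omega>) (?A n)) \<longlonglongrightarrow> 0"
    using lim unfolding Inter measure_empty .
  then have "\<forall>\<^sub>F n in sequentially. measure (lebesgue_on \<Omega>) (?A n) < 2 * \<delta>"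
    using \<delta> by (intro order_tendstoD) auto
  then obtain n where n: "measure (lebesgue_on \<Omega>) (?A n) < 2 * \<delta>"
    by (meson eventually_happens sequentially_bot)
  have "\<bar>x\<bar> \<le> n + \<delta>" if x: "\<epsilon> \<le> torsion_profile \<Omega> x" for x
  proof (rule ccontr)
    assume "\<not> \<bar>x\<bar> \<le> n + \<delta>"
    then have sub: "{x - \<delta><..<x + \<delta>} \<subseteq> ?A n" using ball[OF x] by auto
    have "measure (lebesgue_on \<Omega>) {x - \<delta><..<x + \<delta>} \<le> measure (lebesgue_on \<Omega>) (?A n)"
      by (rule finite_measure_mono[OF sub sets])
    moreover have "measure (lebesgue_on \<Omega>) {x - \<delta><..<x + \<delta>} = 2 * \<delta>"
      using Om ball[OF x] \<delta> by (subst measure_restrict_space) auto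
    ultimately show False using n by simp
  qed
  then have "bounded {x. \<epsilon> \<le> torsion_profile \<Omega> x}"
    by (auto simp: bounded_iff)
  moreover have "closed {x. \<epsilon> \<le> torsion_profile \<Omega> x}"
    using continuous_torsion_profile by (intro closed_Collect_le) auto
  ultimately show ?thesis by (simp add: compact_eq_bounded_closed)
qed

lemma abs_torsion_profile_le: "\<bar>torsion_profile \<Omega> x\<bar> \<le> m\<^sup>2"
proof (cases "x \<in> \<Omega>")
  case True
  note b = component_bounds[OF True] component_length_le[OF True]
  have "(x - lft \<Omega> x) * (rgt \<Omega> x - x) \<le> m * m"
    using b by (intro mult_mono) auto
  moreover have "0 \<le> (x - lft \<Omega> x) * (rgt \<Omega> x - x)" using b by simp
  ultimately show ?thesis using True by (simp add: torsion_profile_def power2_eq_square)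
qed (simp add: torsion_profile_def)

lemma abs_deriv_torsion_profile_le:
  assumes "x \<in> \<Omega>"
  shows "\<bar>deriv (torsion_profile \<Omega>) x\<bar> \<le> m"
proof -
  have "deriv (torsion_profile \<Omega>) x = (lft \<Omega> x + rgt \<Omega> x) / 2 - x"
    using torsion_profile_DERIV[OF assms] by (rule DERIV_imp_deriv)
  with component_bounds[OF assms] component_length_le[OF assms] show ?thesis
    by (simp add: abs_le_iff field_simps)
qed

end

subsection \<open>Test functions and weak derivatives\<close>

lemma test_functionsI:
  assumes "\<And>n. Ck n UNIV \<phi>" "compact K" "K \<subseteq> \<Omega>" "\<And>x. x \<notin> K \<Longrightarrow> \<phi> x = 0"
  shows "\<phi> \<in> test_functions \<Omega>"
proof -
  have sub: "closure {x. \<phi> x \<noteq> 0} \<subseteq> K"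
    using assms(2,4) by (intro closure_minimal compact_imp_closed) auto
  then have "compact (closure {x. \<phi> x \<noteq> 0})"
    using assms(2) compact_imp_bounded bounded_subset compact_eq_bounded_closed closed_closure by metis
  with sub show ?thesis
    using assms(1,3) by (auto simp: test_functions_def Ck_iff)
qed

lemma test_functions_mono: "U \<subseteq> \<Omega> \<Longrightarrow> test_functions U \<subseteq> test_functions \<Omega>"
  by (auto simp: test_functions_def)

lemma test_functions_Ck: "\<phi> \<in> test_functions \<Omega> \<Longrightarrow> Ck n UNIV \<phi>"
  by (auto simp: test_functions_def Ck_iff)

lemma test_functions_DERIV: "\<phi> \<in> test_functions \<Omega> \<Longrightarrow> (\<phi> has_real_derivative deriv \<phi> x) (at x)"
  using Ck_DERIV[OF test_functions_Ck] by blast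

lemma DERIV_zero_off_closed:
  assumes "closed K" "\<And>y. y \<notin> K \<Longrightarrow> f y = 0" "x \<notin> K"
  shows "(f has_real_derivative 0) (at x)"
proof -
  have "((\<lambda>_. 0) has_real_derivative 0) (at x)" by simp
  then show ?thesis
    by (rule has_field_derivative_transform_within_open[where S = "- K"]) (use assms in auto)
qed

lemma test_functions_support:
  assumes "\<phi> \<in> test_functions \<Omega>"
  obtains K where "compact K" "K \<subseteq> \<Omega>" "\<And>x. x \<notin> K \<Longrightarrow> \<phi> x = 0" "\<And>x. x \<notin> K \<Longrightarrow> deriv \<phi> x = 0"
proof -
  define K where "K = closure {x. \<phi> x \<noteq> 0}"
  have K: "compact K" "K \<subseteq> \<Omega>" using assms by (auto simp: K_def test_functions_def)
  have 0: "\<phi> x = 0" if "x \<notin> K" for x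
    using that closure_subset[of "{x. \<phi> x \<noteq> 0}"] by (auto simp: K_def)
  have "deriv \<phi> x = 0" if "x \<notin> K" for x
    using DERIV_zero_off_closed[OF compact_imp_closed[OF K(1)] 0 that] by (rule DERIV_imp_deriv)
  with K 0 that show ?thesis by blast
qed

lemma test_functions_continuous:
  assumes "\<phi> \<in> test_functions \<Omega>"
  shows "continuous_on S \<phi>" "continuous_on S (deriv \<phi>)"
proof -
  have "isCont \<phi> x" "isCont (deriv \<phi>) x" for x
    using Ck_DERIV[OF test_functions_Ck[OF assms, of "Suc 0"], of x]
      Ck_DERIV[of 0 UNIV "deriv \<phi>" x] test_functions_Ck[OF assms, of "Suc (Suc 0)"]
    by (auto intro!: DERIV_isCont)
  then show "continuous_on S \<phi>" "continuous_on S (deriv \<phi>)"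
    by (auto intro: continuous_at_imp_continuous_on)
qed

lemma bounded_of_compact_support:
  fixes f :: "real \<Rightarrow> real"
  assumes "continuous_on UNIV f" "compact K" "\<And>x. x \<notin> K \<Longrightarrow> f x = 0"
  obtains B where "\<And>x. \<bar>f x\<bar> \<le> B"
proof -
  have "bounded (f ` K)"
    using assms by (intro compact_imp_bounded compact_continuous_image) (auto intro: continuous_on_subset)
  then obtain B where "\<And>x. x \<in> K \<Longrightarrow> \<bar>f x\<bar> \<le> B" by (auto simp: bounded_iff)
  then have "\<bar>f x\<bar> \<le> max B 0" for x using assms(3)[of x] by (cases "x \<in> K") (auto simp: le_max_iff_disj)
  then show ?thesis using that by blast
qed

text \<open>The composition is smooth on \<Omega> by the chain rule and zero on the open set where
  \<open>u\<close> is below \<delta>; the two sets cover the line, since \<open>u\<close> vanishes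
  off \<Omega>. The support lies in the compact superlevel set.\<close>

lemma compose_test_function:
  assumes "open \<Omega>" "continuous_on UNIV u" "\<And>n. Ck n \<Omega> u" "\<And>x. x \<notin> \<Omega> \<Longrightarrow> u x = 0"
    and "0 < \<delta>" "compact {x. \<delta> \<le> u x}" "\<And>n. Ck n UNIV f" "\<And>t. t \<le> \<delta> \<Longrightarrow> f t = 0"
  shows "(\<lambda>x. f (u x)) \<in> test_functions \<Omega>"
proof (rule test_functionsI)
  have sub: "{x. \<delta> \<le> u x} \<subseteq> \<Omega>" using assms(4,5) by force
  then show "{x. \<delta> \<le> u x} \<subseteq> \<Omega>" .
  show "compact {x. \<delta> \<le> u x}" by fact
  show "f (u x) = 0" if "x \<notin> {x. \<delta> \<le> u x}" for x
    using that assms(8) by simp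
  fix n
  have "open {x. u x < \<delta>}" using assms(2) by (intro open_Collect_less) auto
  moreover have "Ck n {x. u x < \<delta>} (\<lambda>x. 0)" by simp
  ultimately have "Ck n {x. u x < \<delta>} (\<lambda>x. f (u x))"
    using assms(8) by (elim Ck_cong[rotated 2]) auto
  moreover have "Ck n \<Omega> (\<lambda>x. f (u x))"
    using Ck_compose[OF assms(1) _ assms(7) assms(3)] by simp
  ultimately have "Ck n (\<Omega> \<union> {x. u x < \<delta>}) (\<lambda>x. f (u x))"
    by (intro Ck_Un)
  moreover have "\<Omega> \<union> {x. u x < \<delta>} = UNIV" using sub by force
  ultimately show "Ck n UNIV (\<lambda>x. f (u x))" by simp
qed

text \<open>Integrate over an interval that contains \<open>K\<close> in its interior, where
  \<open>f\<close> vanishes at both ends. The gauge integral admits every pointwise derivative, so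
  it suffices to differentiate everywhere.\<close>

lemma has_integral_deriv_compact_support:
  fixes f :: "real \<Rightarrow> real"
  assumes "\<And>x. (f has_real_derivative g x) (at x)" "compact K" "\<And>x. x \<notin> K \<Longrightarrow> f x = 0"
  shows "(g has_integral 0) UNIV"
proof -
  obtain M where M: "\<And>x. x \<in> K \<Longrightarrow> \<bar>x\<bar> \<le> M"
    using compact_imp_bounded[OF assms(2)] by (auto simp: bounded_iff)
  have "f (\<bar>M\<bar> + 1) = 0" "f (- (\<bar>M\<bar> + 1)) = 0"
    using M[of "\<bar>M\<bar> + 1"] M[of "- (\<bar>M\<bar> + 1)"] by (auto intro!: assms(3))
  moreover have "(g has_integral (f (\<bar>M\<bar> + 1) - f (- (\<bar>M\<bar> + 1)))) {- (\<bar>M\<bar> + 1)..\<bar>M\<bar> + 1}"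
    using assms(1) by (intro fundamental_theorem_of_calculus)
      (auto simp: has_real_derivative_iff_has_vector_derivative[symmetric] has_field_derivative_at_within)
  ultimately have I: "(g has_integral 0) {- (\<bar>M\<bar> + 1)..\<bar>M\<bar> + 1}" by simp
  have "g x = 0" if "x \<notin> K" for x
    using DERIV_unique[OF assms(1) DERIV_zero_off_closed[OF compact_imp_closed[OF assms(2)] assms(3) that]] .
  then show ?thesis
  proof (intro has_integral_on_superset[OF I])
    fix x assume "x \<notin> {- (\<bar>M\<bar> + 1)..\<bar>M\<bar> + 1}"
    then have "x \<notin> K" using M[of x] by auto
    then show "g x = 0" by fact
  qed simp
qed

section \<open>Square-integrable functions and their limits\<close>

lemma L2_integrable_mult:
  assumes "u \<in> L2 \<Omega>" "v \<in> L2 \<Omega>"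
  shows "integrable (lebesgue_on \<Omega>) (\<lambda>x. u x * v x)"
proof (rule Bochner_Integration.integrable_bound)
  show "integrable (lebesgue_on \<Omega>) (\<lambda>x. (u x)\<^sup>2 + (v x)\<^sup>2)"
    using assms by (simp add: L2_def)
  show "(\<lambda>x. u x * v x) \<in> borel_measurable (lebesgue_on \<Omega>)"
    using assms by (auto simp: L2_def)
  have "\<bar>a * b\<bar> \<le> a\<^sup>2 + b\<^sup>2" for a b :: real
  proof -
    have "0 \<le> (\<bar>a\<bar> - \<bar>b\<bar>)\<^sup>2" "0 \<le> \<bar>a\<bar> * \<bar>b\<bar>" by simp_all
    then show ?thesis unfolding abs_mult power2_diff power2_abs by linarith
  qed
  then show "AE x in lebesgue_on \<Omega>. norm (u x * v x) \<le> norm ((u x)\<^sup>2 + (v x)\<^sup>2)"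
    by simp
qed

lemma L2_add_scaled:
  assumes "u \<in> L2 \<Omega>" "v \<in> L2 \<Omega>"
  shows "(\<lambda>x. u x + c * v x) \<in> L2 \<Omega>"
proof -
  have "integrable (lebesgue_on \<Omega>) (\<lambda>x. (u x)\<^sup>2 + 2 * c * (u x * v x) + c\<^sup>2 * (v x)\<^sup>2)"
    using assms L2_integrable_mult[OF assms] by (auto simp: L2_def)
  then have "integrable (lebesgue_on \<Omega>) (\<lambda>x. (u x + c * v x)\<^sup>2)"
    by (simp add: power2_sum power_mult_distrib algebra_simps)
  with assms show ?thesis by (auto simp: L2_def)
qed

lemma L2_diff: "u \<in> L2 \<Omega> \<Longrightarrow> v \<in> L2 \<Omega> \<Longrightarrow> (\<lambda>x. u x - v x) \<in> L2 \<Omega>"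
  using L2_add_scaled[of u \<Omega> v "-1"] by simp

lemma L2_square_integrable: "u \<in> L2 \<Omega> \<Longrightarrow> integrable (lebesgue_on \<Omega>) (\<lambda>x. (u x)\<^sup>2)"
  by (simp add: L2_def)

text \<open>The quadratic A + 2 t C + t^2 B in t is the integral of a square, hence nonnegative for
  all t; suitable values of t give the inequality.\<close>

lemma L2_Cauchy_Schwarz:
  assumes "u \<in> L2 \<Omega>" "v \<in> L2 \<Omega>"
  shows "(LINT x|lebesgue_on \<Omega>. u x * v x)\<^sup>2 \<le>
    (LINT x|lebesgue_on \<Omega>. (u x)\<^sup>2) * (LINT x|lebesgue_on \<Omega>. (v x)\<^sup>2)"
proof -
  define A B C where "A = (LINT x|lebesgue_on \<Omega>. (u x)\<^sup>2)"
    and "B = (LINT x|lebesgue_on \<Omega>. (v x)\<^sup>2)" and "C = (LINT x|lebesgue_on \<Omega>. u x * v x)"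
  have q: "0 \<le> A + 2 * t * C + t\<^sup>2 * B" for t
  proof -
    have "0 \<le> (LINT x|lebesgue_on \<Omega>. (u x + t * v x)\<^sup>2)" by (rule Bochner_Integration.integral_nonneg) simp
    also have "\<dots> = (LINT x|lebesgue_on \<Omega>. (u x)\<^sup>2 + 2 * t * (u x * v x) + t\<^sup>2 * (v x)\<^sup>2)"
      by (simp add: power2_sum power_mult_distrib algebra_simps)
    also have "\<dots> = A + 2 * t * C + t\<^sup>2 * B"
      using assms L2_integrable_mult[OF assms] by (simp add: L2_def A_def B_def C_def)
    finally show ?thesis .
  qed
  have "B \<ge> 0" unfolding B_def by (rule Bochner_Integration.integral_nonneg) simp
  show ?thesis
  proof (cases "B = 0")
    case True
    have "C = 0"
    proof (rule ccontr)
      assume "C \<noteq> 0"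
      \<comment> \<open>With B = 0 the quadratic is linear, and at this t its value is -1.\<close>
      then show False using q[of "- (A + 1) / (2 * C)"] True by (simp add: field_simps)
    qed
    then show ?thesis using True by (simp add: A_def B_def C_def)
  next
    case False
    with \<open>B \<ge> 0\<close> have "0 < B" by simp
    \<comment> \<open>The minimum of the quadratic is at t = - C / B.\<close>
    have "0 \<le> A - C\<^sup>2 / B" using q[of "- C / B"] False by (simp add: field_simps power2_eq_square)
    then have "C\<^sup>2 \<le> A * B" using \<open>0 < B\<close> by (simp add: field_simps)
    then show ?thesis by (simp add: A_def B_def C_def)
  qed
qed

lemma L2_tendsto_mult:
  assumes "\<And>n. \<phi> n \<in> L2 \<Omega>" "u \<in> L2 \<Omega>" "v \<in> L2 \<Omega>"
    and "(\<lambda>n. LINT x|lebesgue_on \<Omega>. (\<phi> n x - u x)\<^sup>2) \<longlonglongrightarrow> 0"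
  shows "(\<lambda>n. LINT x|lebesgue_on \<Omega>. \<phi> n x * v x) \<longlonglongrightarrow> (LINT x|lebesgue_on \<Omega>. u x * v x)"
proof -
  have eq: "(LINT x|lebesgue_on \<Omega>. \<phi> n x * v x) - (LINT x|lebesgue_on \<Omega>. u x * v x)
      = (LINT x|lebesgue_on \<Omega>. (\<phi> n x - u x) * v x)" for n
    using assms L2_integrable_mult by (simp add: left_diff_distrib)
  have "(\<lambda>n. (LINT x|lebesgue_on \<Omega>. (\<phi> n x - u x)\<^sup>2) * (LINT x|lebesgue_on \<Omega>. (v x)\<^sup>2)) \<longlonglongrightarrow>
      0 * (LINT x|lebesgue_on \<Omega>. (v x)\<^sup>2)"
    by (intro tendsto_mult assms(4) tendsto_const)
  then have lim: "(\<lambda>n. (LINT x|lebesgue_on \<Omega>. (\<phi> n x - u x)\<^sup>2) * (LINT x|lebesgue_on \<Omega>. (v x)\<^sup>2)) \<longlonglongrightarrow> 0"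
    by simp
  have "(\<lambda>n. (LINT x|lebesgue_on \<Omega>. (\<phi> n x - u x) * v x)\<^sup>2) \<longlonglongrightarrow> 0"
    by (rule tendsto_sandwich[OF _ _ tendsto_const lim])
      (use L2_Cauchy_Schwarz[OF L2_diff[OF assms(1,2)] assms(3)] in \<open>auto intro!: always_eventually\<close>)
  then have "(\<lambda>n. LINT x|lebesgue_on \<Omega>. (\<phi> n x - u x) * v x) \<longlonglongrightarrow> 0"
    by (simp add: power_tendsto_0_iff)
  then show ?thesis by (subst Lim_null) (simp add: eq)
qed

lemma L2_tendsto_square:
  assumes "\<And>n. \<phi> n \<in> L2 \<Omega>" "u \<in> L2 \<Omega>"
    and "(\<lambda>n. LINT x|lebesgue_on \<Omega>. (\<phi> n x - u x)\<^sup>2) \<longlonglongrightarrow> 0"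
  shows "(\<lambda>n. LINT x|lebesgue_on \<Omega>. (\<phi> n x)\<^sup>2) \<longlonglongrightarrow> (LINT x|lebesgue_on \<Omega>. (u x)\<^sup>2)"
proof -
  have eq: "(LINT x|lebesgue_on \<Omega>. (\<phi> n x)\<^sup>2) = (LINT x|lebesgue_on \<Omega>. (\<phi> n x - u x)\<^sup>2)
      + 2 * (LINT x|lebesgue_on \<Omega>. \<phi> n x * u x) - (LINT x|lebesgue_on \<Omega>. (u x)\<^sup>2)" for n
  proof -
    have "(LINT x|lebesgue_on \<Omega>. (\<phi> n x)\<^sup>2)
        = (LINT x|lebesgue_on \<Omega>. (\<phi> n x - u x)\<^sup>2 + 2 * (\<phi> n x * u x) - (u x)\<^sup>2)"
      by (rule Bochner_Integration.integral_cong) (auto simp: power2_eq_square algebra_simps)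
    then show ?thesis
      using assms(1,2) L2_integrable_mult[OF assms(1,2)] L2_square_integrable[OF L2_diff[OF assms(1,2)]]
      by (simp add: L2_square_integrable)
  qed
  have "(\<lambda>n. LINT x|lebesgue_on \<Omega>. (\<phi> n x)\<^sup>2) \<longlonglongrightarrow>
     0 + 2 * (LINT x|lebesgue_on \<Omega>. u x * u x) - (LINT x|lebesgue_on \<Omega>. (u x)\<^sup>2)"
    unfolding eq by (intro tendsto_intros assms(3) L2_tendsto_mult assms(1,2))
  then show ?thesis by (simp add: power2_eq_square)
qed

context open_finite
begin

lemma sets_Omega: "\<Omega> \<in> sets lebesgue"
  using lmeas_Omega by auto

lemma finite_measure_Omega: "finite_measure (lebesgue_on \<Omega>)"
  using lmeas_Omega by (rule finite_measure_lebesgue_on)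

lemma bounded_L2:
  assumes "u \<in> borel_measurable (lebesgue_on \<Omega>)" "\<And>x. x \<in> \<Omega> \<Longrightarrow> \<bar>u x\<bar> \<le> B"
  shows "u \<in> L2 \<Omega>"
proof -
  interpret finite_measure "lebesgue_on \<Omega>" by (rule finite_measure_Omega)
  have "norm ((u x)\<^sup>2) \<le> B\<^sup>2" if "x \<in> \<Omega>" for x
    using power_mono[OF assms(2)[OF that], of 2] by simp
  then have "integrable (lebesgue_on \<Omega>) (\<lambda>x. (u x)\<^sup>2)"
    using assms(1) by (intro integrable_const_bound[of _ "B\<^sup>2"]) auto
  with assms(1) show ?thesis by (simp add: L2_def)
qed

lemma const_L2: "(\<lambda>x. c) \<in> L2 \<Omega>"
  by (rule bounded_L2[of _ "\<bar>c\<bar>"]) auto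

lemma L2_integrable: "u \<in> L2 \<Omega> \<Longrightarrow> integrable (lebesgue_on \<Omega>) u"
  using L2_integrable_mult[of u \<Omega> "\<lambda>x. 1"] const_L2[of 1] by simp

lemma continuous_bounded_L2:
  assumes "continuous_on \<Omega> u" "\<And>x. x \<in> \<Omega> \<Longrightarrow> \<bar>u x\<bar> \<le> B"
  shows "u \<in> L2 \<Omega>"
  using continuous_imp_measurable_on_sets_lebesgue[OF assms(1) sets_Omega] assms(2) by (rule bounded_L2)

lemma test_functions_L2:
  assumes "\<phi> \<in> test_functions \<Omega>"
  shows "\<phi> \<in> L2 \<Omega>" "deriv \<phi> \<in> L2 \<Omega>"
proof -
  obtain K where K: "compact K" "\<And>x. x \<notin> K \<Longrightarrow> \<phi> x = 0" "\<And>x. x \<notin> K \<Longrightarrow> deriv \<phi> x = 0"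
    using test_functions_support[OF assms] by metis
  obtain B where "\<And>x. \<bar>\<phi> x\<bar> \<le> B"
    using bounded_of_compact_support[OF test_functions_continuous(1)[OF assms] K(1,2)] by blast
  then show "\<phi> \<in> L2 \<Omega>"
    using test_functions_continuous(1)[OF assms] by (intro continuous_bounded_L2)
  obtain B where "\<And>x. \<bar>deriv \<phi> x\<bar> \<le> B"
    using bounded_of_compact_support[OF test_functions_continuous(2)[OF assms] K(1,3)] by blast
  then show "deriv \<phi> \<in> L2 \<Omega>"
    using test_functions_continuous(2)[OF assms] by (intro continuous_bounded_L2)
qed

lemma lint_eq_has_integral:
  fixes g :: "real \<Rightarrow> real"
  assumes "integrable (lebesgue_on \<Omega>) g" "\<And>x. x \<notin> \<Omega> \<Longrightarrow> g x = 0"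
  shows "(g has_integral (LINT x|lebesgue_on \<Omega>. g x)) UNIV"
  using has_integral_on_superset[OF has_integral_integral_lebesgue_on[OF assms(1) sets_Omega] assms(2)] by simp

text \<open>Off \<Omega> the function \<open>u\<close> may be arbitrary, but its product with a test
  function vanishes outside a compact subset of \<Omega> and is therefore differentiable on the
  whole line, with integral of the derivative 0.\<close>

lemma is_weak_derivI:
  assumes "u \<in> L2 \<Omega>" "u' \<in> L2 \<Omega>" "\<And>x. x \<in> \<Omega> \<Longrightarrow> (u has_real_derivative u' x) (at x)"
  shows "is_weak_deriv \<Omega> u u'"
  unfolding is_weak_deriv_def
proof
  fix \<phi> assume \<phi>: "\<phi> \<in> test_functions \<Omega>"
  obtain K where K: "compact K" "K \<subseteq> \<Omega>" "\<And>x. x \<notin> K \<Longrightarrow> \<phi> x = 0" "\<And>x. x \<notin> K \<Longrightarrow> deriv \<phi> x = 0"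
    using test_functions_support[OF \<phi>] by metis
  have D: "((\<lambda>x. u x * \<phi> x) has_real_derivative (u x * deriv \<phi> x + u' x * \<phi> x)) (at x)" for x
  proof (cases "x \<in> K")
    case True
    then show ?thesis
      using DERIV_mult'[OF assms(3) test_functions_DERIV[OF \<phi>]] K(2) by auto
  next
    case False
    then show ?thesis
      using DERIV_zero_off_closed[OF compact_imp_closed[OF K(1)], of "\<lambda>x. u x * \<phi> x"] K(3,4) by simp
  qed
  have int: "integrable (lebesgue_on \<Omega>) (\<lambda>x. u x * deriv \<phi> x)" "integrable (lebesgue_on \<Omega>) (\<lambda>x. u' x * \<phi> x)"
    using assms(1,2) test_functions_L2[OF \<phi>] by (simp_all add: L2_integrable_mult)
  have "((\<lambda>x. u x * deriv \<phi> x + u' x * \<phi> x) has_integral 0) UNIV"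
    by (rule has_integral_deriv_compact_support[OF D K(1)]) (simp add: K(3))
  moreover have "((\<lambda>x. u x * deriv \<phi> x + u' x * \<phi> x) has_integral
      (LINT x|lebesgue_on \<Omega>. u x * deriv \<phi> x + u' x * \<phi> x)) UNIV"
  proof (rule lint_eq_has_integral)
    show "u x * deriv \<phi> x + u' x * \<phi> x = 0" if "x \<notin> \<Omega>" for x
    proof -
      have "x \<notin> K" using that K(2) by blast
      then show ?thesis by (simp add: K(3,4))
    qed
  qed (use int in simp)
  ultimately have "(LINT x|lebesgue_on \<Omega>. u x * deriv \<phi> x + u' x * \<phi> x) = 0"
    by (rule has_integral_unique[symmetric])
  then show "(LINT x|lebesgue_on \<Omega>. u x * deriv \<phi> x) = - (LINT x|lebesgue_on \<Omega>. u' x * \<phi> x)"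
    using int by simp
qed

section \<open>The fundamental lemma of the calculus of variations\<close>

text \<open>\<open>U\<close> is itself an open set of finite measure, so cut-offs of its own torsion
  profile are test functions that converge pointwise to its indicator; \<open>\<bar>h\<bar>\<close>
  dominates.\<close>

lemma lint_open_subset_eq_0:
  assumes h: "h \<in> L2 \<Omega>" and 0: "\<And>\<phi>. \<phi> \<in> test_functions \<Omega> \<Longrightarrow> (LINT x|lebesgue_on \<Omega>. h x * \<phi> x) = 0"
    and U: "open U" "U \<subseteq> \<Omega>"
  shows "(LINT x|lebesgue_on \<Omega>. h x * indicator U x) = 0"
proof -
  interpret U: open_finite U
    using U lmeas_Omega by unfold_locales
      (auto intro: fmeasurableI2)
  define \<phi> where "\<phi> = (\<lambda>n x. flat_fun [:1:] (real (Suc n) * torsion_profile U x - 1))"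
  have "(\<lambda>x. flat_fun [:1:] (real (Suc n) * torsion_profile U x - 1)) \<in> test_functions U" for n
    by (rule compose_test_function[OF U(1) U.continuous_torsion_profile U.Ck_torsion_profile _ _
          U.compact_torsion_profile_ge[of "1 / real (Suc n)"] Ck_flat_fun_affine])
      (auto simp: torsion_profile_def flat_fun_def field_simps)
  then have test: "\<phi> n \<in> test_functions \<Omega>" for n
    using test_functions_mono[OF U(2)] by (auto simp: \<phi>_def)
  have lim: "(\<lambda>n. \<phi> n x) \<longlonglongrightarrow> indicator U x" for x
  proof (cases "x \<in> U")
    case True
    then show ?thesis
      using flat_fun_scaled_tendsto[OF U.torsion_profile_pos, of x "[:1:]"] by (simp add: \<phi>_def)
  qed (simp add: \<phi>_def torsion_profile_def flat_fun_def)
  have "(\<lambda>n. LINT x|lebesgue_on \<Omega>. h x * \<phi> n x) \<longlonglongrightarrow> (LINT x|lebesgue_on \<Omega>. h x * indicator U x)"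
  proof (rule integral_dominated_convergence[where w = "\<lambda>x. \<bar>h x\<bar>"])
    show "AE x in lebesgue_on \<Omega>. (\<lambda>n. h x * \<phi> n x) \<longlonglongrightarrow> h x * indicator U x"
      using lim by (intro AE_I2 tendsto_mult tendsto_const)
    show "integrable (lebesgue_on \<Omega>) (\<lambda>x. \<bar>h x\<bar>)" using L2_integrable[OF h] by simp
    show "(\<lambda>x. h x * \<phi> n x) \<in> borel_measurable (lebesgue_on \<Omega>)" for n
      using h test_functions_L2(1)[OF test, of n] by (auto simp: L2_def)
    show "AE x in lebesgue_on \<Omega>. norm (h x * \<phi> n x) \<le> \<bar>h x\<bar>" for n
      using flat_fun_bounds by (auto simp: \<phi>_def abs_mult intro!: mult_right_le_one_le)
    have "indicat_real U \<in> borel_measurable (lebesgue_on \<Omega>)"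
      using U by (intro borel_measurable_indicator) (auto simp: sets_restrict_space_iff sets_Omega)
    then show "(\<lambda>x. h x * indicator U x) \<in> borel_measurable (lebesgue_on \<Omega>)"
      using h by (auto simp: L2_def)
  qed
  then show ?thesis using 0[OF test] by (simp add: LIMSEQ_const_iff)
qed

text \<open>Outer regularity: \<open>A\<close> sits in an open subset of \<Omega> up to a set of
  measure at most e. The integral over the open set is 0, and by the Cauchy-Schwarz inequality the
  square of the error is at most e times the integral of \<open>h\<close> squared.\<close>

lemma lint_subset_eq_0:
  assumes h: "h \<in> L2 \<Omega>" and 0: "\<And>\<phi>. \<phi> \<in> test_functions \<Omega> \<Longrightarrow> (LINT x|lebesgue_on \<Omega>. h x * \<phi> x) = 0"
    and A: "A \<in> sets lebesgue" "A \<subseteq> \<Omega>"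
  shows "(LINT x|lebesgue_on \<Omega>. h x * indicator A x) = 0"
proof -
  define I where "I = (LINT x|lebesgue_on \<Omega>. h x * indicator A x)"
  define H where "H = (LINT x|lebesgue_on \<Omega>. (h x)\<^sup>2)"
  have ind: "indicat_real S \<in> L2 \<Omega>" if "S \<in> sets lebesgue" "S \<subseteq> \<Omega>" for S
    by (rule bounded_L2[of _ 1])
      (use that in \<open>auto intro!: borel_measurable_indicator simp: sets_restrict_space_iff sets_Omega indicator_def\<close>)
  have H: "0 \<le> H" unfolding H_def by (rule Bochner_Integration.integral_nonneg) simp
  have le: "I\<^sup>2 \<le> H * e" if e: "e > 0" for e
  proof -
    obtain T where T: "open T" "A \<subseteq> T" "T - A \<in> lmeasurable" "emeasure lebesgue (T - A) < ennreal e"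
      using sets_lebesgue_outer_open[OF A(1) e] by blast
    have sets: "T \<inter> \<Omega> \<in> sets lebesgue" "T \<inter> \<Omega> - A \<in> sets lebesgue"
      using T(1) open_Omega A(1) by auto
    have "I = (LINT x|lebesgue_on \<Omega>. h x * indicator (T \<inter> \<Omega>) x - h x * indicator (T \<inter> \<Omega> - A) x)"
      unfolding I_def using T(2) A(2)
      by (intro Bochner_Integration.integral_cong) (auto simp: indicator_def)
    also have "\<dots> = - (LINT x|lebesgue_on \<Omega>. h x * indicator (T \<inter> \<Omega> - A) x)"
    proof -
      have "(LINT x|lebesgue_on \<Omega>. h x * indicator (T \<inter> \<Omega>) x) = 0"
        by (rule lint_open_subset_eq_0[OF h 0]) (use T(1) open_Omega in auto)
      moreover have "indicat_real (T \<inter> \<Omega>) \<in> L2 \<Omega>" "indicat_real (T \<inter> \<Omega> - A) \<in> L2 \<Omega>"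
        by (rule ind; use sets in auto)+
      ultimately show ?thesis using L2_integrable_mult[OF h] by simp
    qed
    finally have "I\<^sup>2 \<le> H * (LINT x|lebesgue_on \<Omega>. (indicat_real (T \<inter> \<Omega> - A) x)\<^sup>2)"
      using L2_Cauchy_Schwarz[OF h ind[OF sets(2)]] by (auto simp: H_def)
    also have "(LINT x|lebesgue_on \<Omega>. (indicat_real (T \<inter> \<Omega> - A) x)\<^sup>2) = measure lebesgue (T \<inter> \<Omega> - A)"
    proof -
      have "(indicat_real (T \<inter> \<Omega> - A) x)\<^sup>2 = indicat_real (T \<inter> \<Omega> - A) x" for x
        by (simp add: indicator_def)
      moreover have "(T \<inter> \<Omega> - A) \<inter> \<Omega> = T \<inter> \<Omega> - A" "T \<inter> \<Omega> - A \<subseteq> \<Omega>" by auto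
      ultimately show ?thesis
        using sets sets_Omega by (simp add: measure_restrict_space)
    qed
    also have "\<dots> \<le> measure lebesgue (T - A)"
      by (rule measure_mono_fmeasurable) (use T sets in auto)
    also have "\<dots> \<le> e"
      using T(3,4) that by (simp add: emeasure_eq_measure2 ennreal_less_iff)
    finally show ?thesis using H by (simp add: mult_left_mono)
  qed
  then have "I\<^sup>2 \<le> 0 + e" if "e > 0" for e
  proof -
    have "I\<^sup>2 \<le> H * (e / (H + 1))" using le[of "e / (H + 1)"] H that by simp
    also have "\<dots> \<le> e" using H that by (simp add: field_simps)
    finally show ?thesis by simp
  qed
  then have "I\<^sup>2 \<le> 0" by (rule field_le_epsilon)
  then show ?thesis by (simp add: I_def)
qed

lemma AE_eq_0_of_test_functions:
  assumes h: "h \<in> L2 \<Omega>" and 0: "\<And>\<phi>. \<phi> \<in> test_functions \<Omega> \<Longrightarrow> (LINT x|lebesgue_on \<Omega>. h x * \<phi> x) = 0"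
  shows "AE x in lebesgue_on \<Omega>. h x = 0"
proof -
  have hm[measurable]: "h \<in> borel_measurable (lebesgue_on \<Omega>)" using h by (simp add: L2_def)
  have m: "{x \<in> \<Omega>. 0 < h x} \<in> sets (lebesgue_on \<Omega>)" "{x \<in> \<Omega>. h x < 0} \<in> sets (lebesgue_on \<Omega>)"
    using borel_measurable_less[of "\<lambda>_. 0" "lebesgue_on \<Omega>" h] borel_measurable_less[of h "lebesgue_on \<Omega>" "\<lambda>_. 0"]
    by simp_all
  then have s: "{x \<in> \<Omega>. 0 < h x} \<in> sets lebesgue" "{x \<in> \<Omega>. h x < 0} \<in> sets lebesgue"
    by (auto simp: sets_restrict_space_iff sets_Omega)
  have i: "integrable (lebesgue_on \<Omega>) (\<lambda>x. h x * indicator {x \<in> \<Omega>. 0 < h x} x)"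
    "integrable (lebesgue_on \<Omega>) (\<lambda>x. h x * indicator {x \<in> \<Omega>. h x < 0} x)"
    by (intro integrable_real_mult_indicator m L2_integrable h)+
  have z: "(LINT x|lebesgue_on \<Omega>. h x * indicator {x \<in> \<Omega>. 0 < h x} x) = 0"
    "(LINT x|lebesgue_on \<Omega>. h x * indicator {x \<in> \<Omega>. h x < 0} x) = 0"
    by (rule lint_subset_eq_0[OF h 0]; use s in auto)+
  have "AE x in lebesgue_on \<Omega>. h x * indicator {x \<in> \<Omega>. 0 < h x} x = 0"
    using z(1)
    by (subst (asm) integral_nonneg_eq_0_iff_AE[OF i(1)]) (auto simp: indicator_def)
  moreover have "AE x in lebesgue_on \<Omega>. - (h x * indicator {x \<in> \<Omega>. h x < 0} x) = 0"
    using z(2)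
    by (subst integral_nonneg_eq_0_iff_AE[symmetric]) (use i(2) in \<open>auto simp: indicator_def\<close>)
  ultimately show ?thesis
    using AE_space
  proof eventually_elim
    case (elim x)
    then show ?case by (cases "h x" "0 :: real" rule: linorder_cases) auto
  qed
qed

text \<open>The difference integrates to 0 against every test function. This allows the arbitrary
  choice in \<open>weak_deriv\<close> to be replaced by a classical derivative.\<close>

lemma is_weak_deriv_unique:
  assumes "g1 \<in> L2 \<Omega>" "g2 \<in> L2 \<Omega>" "is_weak_deriv \<Omega> u g1" "is_weak_deriv \<Omega> u g2"
  shows "AE x in lebesgue_on \<Omega>. g1 x = g2 x"
proof -
  have "AE x in lebesgue_on \<Omega>. g1 x - g2 x = 0"
  proof (rule AE_eq_0_of_test_functions)
    fix \<phi> assume \<phi>: "\<phi> \<in> test_functions \<Omega>"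
    have "integrable (lebesgue_on \<Omega>) (\<lambda>x. g1 x * \<phi> x)" "integrable (lebesgue_on \<Omega>) (\<lambda>x. g2 x * \<phi> x)"
      using assms(1,2) test_functions_L2[OF \<phi>] by (simp_all add: L2_integrable_mult)
    then show "(LINT x|lebesgue_on \<Omega>. (g1 x - g2 x) * \<phi> x) = 0"
      using assms(3,4) \<phi> by (auto simp: is_weak_deriv_def left_diff_distrib)
  qed (use assms L2_diff in auto)
  then show ?thesis by simp
qed

lemma weak_deriv_props:
  assumes "u \<in> H1 \<Omega>"
  shows "u \<in> L2 \<Omega>" "weak_deriv \<Omega> u \<in> L2 \<Omega>" "is_weak_deriv \<Omega> u (weak_deriv \<Omega> u)"
  using assms someI_ex[of "\<lambda>g. g \<in> L2 \<Omega> \<and> is_weak_deriv \<Omega> u g"]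
  by (auto simp: H1_def weak_deriv_def)

end

section \<open>Smooth truncation and membership in \<open>H10\<close>\<close>

definition trunc_fun :: "nat \<Rightarrow> real \<Rightarrow> real" where
  "trunc_fun n t = t * flat_fun [:1:] (real (Suc n) * t - 1)"

lemma Ck_trunc_fun: "Ck k UNIV (trunc_fun n)"
proof -
  have "Ck k UNIV (\<lambda>t. t * flat_fun [:1:] (real (Suc n) * t - 1))"
    by (rule Ck_mult[OF _ _ Ck_flat_fun_affine]) simp_all
  then show ?thesis by (simp add: trunc_fun_def[abs_def])
qed

text \<open>In s = (n + 1) t - 1 the factor (n + 1) t of the product rule is s + 1, so
  \<open>n\<close> enters the derivative through s alone. Any bound on this one function of s is
  thus uniform in \<open>n\<close>.\<close>

lemma trunc_fun_DERIV:
  "(trunc_fun n has_real_derivative flat_fun [:1, 1, 1:] (real (Suc n) * t - 1)) (at t)"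
proof -
  define s where "s = real (Suc n) * t - 1"
  have "((\<lambda>t. real (Suc n) * t - 1) has_real_derivative real (Suc n)) (at t)"
    by (auto intro!: derivative_eq_intros)
  from DERIV_mult'[OF DERIV_ident DERIV_chain2[OF flat_fun_DERIV[of "[:1:]"] this]]
  have "(trunc_fun n has_real_derivative
      t * (flat_fun [:0, 0, 1:] s * real (Suc n)) + flat_fun [:1:] s) (at t)"
    by (simp add: trunc_fun_def[abs_def] s_def)
  moreover have "t * (flat_fun [:0, 0, 1:] s * real (Suc n)) + flat_fun [:1:] s = flat_fun [:1, 1, 1:] s"
  proof -
    have "t * (flat_fun [:0, 0, 1:] s * real (Suc n)) = (s + 1) * flat_fun [:0, 0, 1:] s"
      by (simp add: s_def)
    then show ?thesis by (simp add: flat_fun_def field_simps)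
  qed
  ultimately show ?thesis by (simp add: s_def)
qed

text \<open>With r = 1 / s the value is (1 + r + r^2) exp (- r), and 1 + r + r^2 is at most 3 (1 + r
  + r^2 / 2), hence at most 3 exp r.\<close>

lemma abs_flat_fun_le: "\<bar>flat_fun [:1, 1, 1:] s\<bar> \<le> 3"
proof (cases "s > 0")
  case True
  define r where "r = 1 / s"
  have r: "r > 0" using True by (simp add: r_def)
  have "1 + r + r\<^sup>2 / 2 \<le> exp r" using r exp_lower_Taylor_quadratic[of r] by simp
  then have "1 + r + r\<^sup>2 \<le> 3 * exp r" using r zero_le_power2[of r] by argo
  then have "(1 + r + r\<^sup>2) * exp (- r) \<le> 3" by (simp add: exp_minus field_simps)
  moreover have "flat_fun [:1, 1, 1:] s = (1 + r + r\<^sup>2) * exp (- r)"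
    using True by (simp add: flat_fun_def r_def power2_eq_square field_simps)
  moreover have "0 \<le> (1 + r + r\<^sup>2) * exp (- r)" using r by simp
  ultimately show ?thesis by simp
qed (simp add: flat_fun_def)

context open_finite
begin

lemma bounded_tendsto_L2:
  fixes f :: "nat \<Rightarrow> real \<Rightarrow> real"
  assumes "\<And>n. f n \<in> borel_measurable (lebesgue_on \<Omega>)" "\<And>n x. x \<in> \<Omega> \<Longrightarrow> \<bar>f n x\<bar> \<le> B"
    and "\<And>x. x \<in> \<Omega> \<Longrightarrow> (\<lambda>n. f n x) \<longlonglongrightarrow> 0"
  shows "(\<lambda>n. LINT x|lebesgue_on \<Omega>. (f n x)\<^sup>2) \<longlonglongrightarrow> 0"
proof -
  interpret finite_measure "lebesgue_on \<Omega>" by (rule finite_measure_Omega)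
  have "(\<lambda>n. LINT x|lebesgue_on \<Omega>. (f n x)\<^sup>2) \<longlonglongrightarrow> (LINT x|lebesgue_on \<Omega>. 0)"
  proof (rule integral_dominated_convergence[where w = "\<lambda>_. B\<^sup>2"])
    show "AE x in lebesgue_on \<Omega>. (\<lambda>n. (f n x)\<^sup>2) \<longlonglongrightarrow> 0"
      using tendsto_power[OF assms(3), of _ 2] by (intro AE_I2) simp
    show "AE x in lebesgue_on \<Omega>. norm ((f n x)\<^sup>2) \<le> B\<^sup>2" for n
      using power_mono[OF assms(2), of _ n 2] by (intro AE_I2) simp
  qed (use assms(1) in auto)
  then show ?thesis by simp
qed

text \<open>The truncations of \<open>u\<close> are test functions; they and their derivatives
  converge pointwise on \<Omega> under bounds independent of \<open>n\<close>, so dominated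
  convergence on a set of finite measure gives convergence in the norm of the space.\<close>

lemma H10I:
  assumes cont: "continuous_on UNIV u" and smooth: "\<And>n. Ck n \<Omega> u"
    and 0: "\<And>x. x \<notin> \<Omega> \<Longrightarrow> u x = 0" and pos: "\<And>x. 0 \<le> u x"
    and cpt: "\<And>\<delta>. 0 < \<delta> \<Longrightarrow> compact {x. \<delta> \<le> u x}"
    and bd: "\<And>x. x \<in> \<Omega> \<Longrightarrow> \<bar>u x\<bar> \<le> B" "\<And>x. x \<in> \<Omega> \<Longrightarrow> \<bar>deriv u x\<bar> \<le> B"
  shows "u \<in> H10 \<Omega>" and "deriv u \<in> L2 \<Omega>" and "AE x in lebesgue_on \<Omega>. weak_deriv \<Omega> u x = deriv u x"
proof -
  have D: "(u has_real_derivative deriv u x) (at x)" if "x \<in> \<Omega>" for x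
    using Ck_DERIV[OF smooth that] .
  have "isCont (deriv u) x" if "x \<in> \<Omega>" for x
    using Ck_DERIV[of 0 \<Omega> "deriv u" x] smooth[of "Suc (Suc 0)"] that by (auto intro: DERIV_isCont)
  then have u': "deriv u \<in> L2 \<Omega>"
    using bd(2) by (intro continuous_bounded_L2 continuous_at_imp_continuous_on) auto
  then show "deriv u \<in> L2 \<Omega>" .
  have u: "u \<in> L2 \<Omega>"
    using bd(1) cont by (intro continuous_bounded_L2) (auto intro: continuous_on_subset)
  have weak: "is_weak_deriv \<Omega> u (deriv u)"
    using u u' D by (rule is_weak_derivI)
  then have H1: "u \<in> H1 \<Omega>" using u u' by (auto simp: H1_def)
  note wd = weak_deriv_props[OF H1]
  show AE: "AE x in lebesgue_on \<Omega>. weak_deriv \<Omega> u x = deriv u x"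
    using is_weak_deriv_unique[OF wd(2) u' wd(3) weak] .
  define \<phi> where "\<phi> = (\<lambda>n x. trunc_fun n (u x))"
  have test: "\<phi> n \<in> test_functions \<Omega>" for n
    unfolding \<phi>_def
    by (rule compose_test_function[OF open_Omega cont smooth 0 _ cpt[of "1 / real (Suc n)"] Ck_trunc_fun])
      (auto simp: trunc_fun_def flat_fun_def field_simps)
  have D\<phi>: "deriv (\<phi> n) x = flat_fun [:1, 1, 1:] (real (Suc n) * u x - 1) * deriv u x" if "x \<in> \<Omega>" for n x
    using DERIV_chain2[OF trunc_fun_DERIV D[OF that], of n] by (intro DERIV_imp_deriv) (simp add: \<phi>_def)
  have "(\<lambda>n. LINT x|lebesgue_on \<Omega>. (\<phi> n x - u x)\<^sup>2) \<longlonglongrightarrow> 0"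
  proof (rule bounded_tendsto_L2)
    show "(\<lambda>x. \<phi> n x - u x) \<in> borel_measurable (lebesgue_on \<Omega>)" for n
      using L2_diff[OF test_functions_L2(1)[OF test] u] by (simp add: L2_def)
    fix x assume x: "x \<in> \<Omega>"
    show "\<bar>\<phi> n x - u x\<bar> \<le> B" for n
    proof -
      have "\<phi> n x \<le> u x" "0 \<le> \<phi> n x"
        using flat_fun_bounds pos by (auto simp: \<phi>_def trunc_fun_def intro: mult_right_le_one_le)
      then show ?thesis using bd(1)[OF x] by simp
    qed
    show "(\<lambda>n. \<phi> n x - u x) \<longlonglongrightarrow> 0"
    proof (cases "u x = 0")
      case True
      then show ?thesis by (simp add: \<phi>_def trunc_fun_def)
    next
      case False
      then have "u x > 0" using pos[of x] by simp
      then have "(\<lambda>n. u x * flat_fun [:1:] (real (Suc n) * u x - 1) - u x) \<longlonglongrightarrow> u x * poly [:1:] 0 - u x"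
        by (intro tendsto_intros flat_fun_scaled_tendsto)
      then show ?thesis by (simp add: \<phi>_def trunc_fun_def)
    qed
  qed
  moreover have "(\<lambda>n. LINT x|lebesgue_on \<Omega>. (deriv (\<phi> n) x - weak_deriv \<Omega> u x)\<^sup>2) \<longlonglongrightarrow> 0"
  proof -
    have "(\<lambda>n. LINT x|lebesgue_on \<Omega>. (deriv (\<phi> n) x - deriv u x)\<^sup>2) \<longlonglongrightarrow> 0"
    proof (rule bounded_tendsto_L2)
      show "(\<lambda>x. deriv (\<phi> n) x - deriv u x) \<in> borel_measurable (lebesgue_on \<Omega>)" for n
        using L2_diff[OF test_functions_L2(2)[OF test] u'] by (simp add: L2_def)
      fix x assume x: "x \<in> \<Omega>"
      \<comment> \<open>The truncation multiplies the derivative by a factor of modulus at most 3,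
        and \<open>deriv u\<close> itself adds one more \<open>B\<close>.\<close>
      show "\<bar>deriv (\<phi> n) x - deriv u x\<bar> \<le> 4 * B" for n
      proof -
        have "\<bar>deriv (\<phi> n) x\<bar> \<le> 3 * B"
          unfolding D\<phi>[OF x] abs_mult using abs_flat_fun_le bd(2)[OF x] by (intro mult_mono) auto
        then show ?thesis using bd(2)[OF x] by simp
      qed
      show "(\<lambda>n. deriv (\<phi> n) x - deriv u x) \<longlonglongrightarrow> 0"
      proof (cases "u x = 0")
        case True
        \<comment> \<open>A zero of a nonnegative function inside \<Omega> is a minimum. Without
          this the limit would be wrong there: the truncated derivatives vanish at such a point. It
          matters for a sine arch, which is zero on all other components.\<close>
        then have "deriv u x = 0"
          using DERIV_local_min[OF D[OF x], of 1] pos by simp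
        then show ?thesis by (simp add: D\<phi>[OF x])
      next
        case False
        then have "u x > 0" using pos[of x] by simp
        then have "(\<lambda>n. flat_fun [:1, 1, 1:] (real (Suc n) * u x - 1) * deriv u x - deriv u x) \<longlonglongrightarrow>
            poly [:1, 1, 1:] 0 * deriv u x - deriv u x"
          by (intro tendsto_intros flat_fun_scaled_tendsto)
        then show ?thesis by (simp add: D\<phi>[OF x])
      qed
    qed
    moreover have "(LINT x|lebesgue_on \<Omega>. (deriv (\<phi> n) x - weak_deriv \<Omega> u x)\<^sup>2)
        = (LINT x|lebesgue_on \<Omega>. (deriv (\<phi> n) x - deriv u x)\<^sup>2)" for n
    proof (rule integral_cong_AE)
      show "(\<lambda>x. (deriv (\<phi> n) x - weak_deriv \<Omega> u x)\<^sup>2) \<in> borel_measurable (lebesgue_on \<Omega>)"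
        using L2_square_integrable[OF L2_diff[OF test_functions_L2(2)[OF test] wd(2)]] by simp
      show "(\<lambda>x. (deriv (\<phi> n) x - deriv u x)\<^sup>2) \<in> borel_measurable (lebesgue_on \<Omega>)"
        using L2_square_integrable[OF L2_diff[OF test_functions_L2(2)[OF test] u']] by simp
    qed (use AE in auto)
    ultimately show ?thesis by simp
  qed
  ultimately have "(\<lambda>n. (LINT x|lebesgue_on \<Omega>. (\<phi> n x - u x)\<^sup>2)
      + (LINT x|lebesgue_on \<Omega>. (deriv (\<phi> n) x - weak_deriv \<Omega> u x)\<^sup>2)) \<longlonglongrightarrow> 0 + 0"
    by (rule tendsto_add)
  then show "u \<in> H10 \<Omega>"
    using H1 test unfolding H10_def by auto
qed

lemma H10E:
  assumes "u \<in> H10 \<Omega>"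
  obtains \<phi> where "\<And>n. \<phi> n \<in> test_functions \<Omega>"
    "(\<lambda>n. LINT x|lebesgue_on \<Omega>. (\<phi> n x - u x)\<^sup>2) \<longlonglongrightarrow> 0"
    "(\<lambda>n. LINT x|lebesgue_on \<Omega>. (deriv (\<phi> n) x - weak_deriv \<Omega> u x)\<^sup>2) \<longlonglongrightarrow> 0"
proof -
  obtain \<phi> where \<phi>: "\<And>n. \<phi> n \<in> test_functions \<Omega>"
    and lim: "(\<lambda>n. (LINT x|lebesgue_on \<Omega>. (\<phi> n x - u x)\<^sup>2)
        + (LINT x|lebesgue_on \<Omega>. (deriv (\<phi> n) x - weak_deriv \<Omega> u x)\<^sup>2)) \<longlonglongrightarrow> 0"
    using assms by (auto simp: H10_def)
  have nn: "0 \<le> (LINT x|lebesgue_on \<Omega>. (f x)\<^sup>2)" for f :: "real \<Rightarrow> real"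
    by (rule Bochner_Integration.integral_nonneg) simp
  show ?thesis
  proof (rule that[of \<phi>])
    show "(\<lambda>n. LINT x|lebesgue_on \<Omega>. (\<phi> n x - u x)\<^sup>2) \<longlonglongrightarrow> 0"
      "(\<lambda>n. LINT x|lebesgue_on \<Omega>. (deriv (\<phi> n) x - weak_deriv \<Omega> u x)\<^sup>2) \<longlonglongrightarrow> 0"
      by (rule tendsto_sandwich[OF _ _ tendsto_const lim]; simp add: nn)+
  qed (rule \<phi>)
qed

lemma H10_props:
  assumes "u \<in> H10 \<Omega>"
  shows "u \<in> L2 \<Omega>" "weak_deriv \<Omega> u \<in> L2 \<Omega>"
  using weak_deriv_props[of u] assms by (auto simp: H10_def)

subsection \<open>The first eigenvalue and the torsional rigidity\<close>

text \<open>With \<open>k = \<pi> / L\<close> and \<open>c = k cot (k (x - a))\<close> on a component with left endpoint \<open>a\<close>, Riccati's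
  equation \<open>c' = - k\<^sup>2 - c\<^sup>2\<close> gives \<open>\<phi>'\<^sup>2 - k\<^sup>2 \<phi>\<^sup>2 = (c \<phi>\<^sup>2)' + (\<phi>' - c \<phi>)\<^sup>2\<close>.\<close>

lemma Poincare_test_functions:
  assumes \<phi>: "\<phi> \<in> test_functions \<Omega>" and L: "0 < L" "\<And>x. x \<in> \<Omega> \<Longrightarrow> rgt \<Omega> x - lft \<Omega> x \<le> L"
  shows "(pi / L)\<^sup>2 * (LINT x|lebesgue_on \<Omega>. (\<phi> x)\<^sup>2) \<le> (LINT x|lebesgue_on \<Omega>. (deriv \<phi> x)\<^sup>2)"
proof -
  define k where "k = pi / L"
  have k: "k > 0" using L by (simp add: k_def)
  define c where "c = (\<lambda>a x. k * cos (k * (x - a)) / sin (k * (x - a)))"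
  obtain K where K: "compact K" "K \<subseteq> \<Omega>" "\<And>x. x \<notin> K \<Longrightarrow> \<phi> x = 0" "\<And>x. x \<notin> K \<Longrightarrow> deriv \<phi> x = 0"
    using test_functions_support[OF \<phi>] by metis
  \<comment> \<open>On the closure of a component the poles of \<open>c\<close> can only be its
    endpoints, which lie off \<open>K\<close>; so the product with the square of \<phi> is
    differentiable everywhere.\<close>
  define g where "g = (\<lambda>x. if x \<in> K then 2 * \<phi> x * deriv \<phi> x * c (lft \<Omega> x) x
      - (\<phi> x)\<^sup>2 * (k\<^sup>2 + (c (lft \<Omega> x) x)\<^sup>2) else 0)"
  have D: "((\<lambda>x. (\<phi> x)\<^sup>2 * c (lft \<Omega> x) x) has_real_derivative g x) (at x)" for x
  proof (cases "x \<in> K")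
    case True
    then have x: "x \<in> \<Omega>" using K(2) by blast
    note b = component_bounds[OF x]
    define s where "s = sin (k * (x - lft \<Omega> x))"
    define co where "co = cos (k * (x - lft \<Omega> x))"
    \<comment> \<open>The bound on the component lengths enters here: k (x - a) stays strictly
      between 0 and \<pi>, where the sine has no zero.\<close>
    have "x - lft \<Omega> x < L" using b L(2)[OF x] by simp
    then have "k * (x - lft \<Omega> x) < k * L" using k by simp
    also have "k * L = pi" using L by (simp add: k_def)
    finally have s: "s \<noteq> 0"
      using b k sin_gt_zero[of "k * (x - lft \<Omega> x)"] by (simp add: s_def)
    have sc: "s\<^sup>2 + co\<^sup>2 = 1" by (simp add: s_def co_def)
    have "(c (lft \<Omega> x) has_real_derivative
        (- (k * (s * k)) * s - k * co * (co * k)) / (s * s)) (at x)"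
      unfolding c_def s_def co_def
      using s by (auto intro!: derivative_eq_intros simp: s_def)
    moreover have "(- (k * (s * k)) * s - k * co * (co * k)) / (s * s) = - (k\<^sup>2 + (k * co / s)\<^sup>2)"
      using s by (simp add: field_simps power2_eq_square)
    ultimately have Dc: "(c (lft \<Omega> x) has_real_derivative - (k\<^sup>2 + (c (lft \<Omega> x) x)\<^sup>2)) (at x)"
      by (simp add: c_def s_def co_def)
    have "((\<lambda>y. (\<phi> y)\<^sup>2 * c (lft \<Omega> x) y) has_real_derivative g x) (at x)"
      unfolding g_def using True
      by (auto intro!: derivative_eq_intros test_functions_DERIV[OF \<phi>] Dc simp: algebra_simps)
    then show ?thesis
    proof (rule has_field_derivative_transform_within_open[where S = "{lft \<Omega> x<..<rgt \<Omega> x}"])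
      show "(\<phi> y)\<^sup>2 * c (lft \<Omega> x) y = (\<phi> y)\<^sup>2 * c (lft \<Omega> y) y" if "y \<in> {lft \<Omega> x<..<rgt \<Omega> x}" for y
        using component_same[OF x, of y] that by simp
    qed (use b in auto)
  next
    case False
    then show ?thesis
      using DERIV_zero_off_closed[OF compact_imp_closed[OF K(1)]] K(3) by (simp add: g_def)
  qed
  have 1: "(g has_integral 0) UNIV"
    by (rule has_integral_deriv_compact_support[OF D K(1)]) (simp add: K(3))
  note sq = L2_square_integrable[OF test_functions_L2(1)[OF \<phi>]] L2_square_integrable[OF test_functions_L2(2)[OF \<phi>]]
  have 2: "((\<lambda>x. (deriv \<phi> x)\<^sup>2 - k\<^sup>2 * (\<phi> x)\<^sup>2) has_integral
      (LINT x|lebesgue_on \<Omega>. (deriv \<phi> x)\<^sup>2 - k\<^sup>2 * (\<phi> x)\<^sup>2)) UNIV"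
  proof (rule lint_eq_has_integral)
    show "(deriv \<phi> x)\<^sup>2 - k\<^sup>2 * (\<phi> x)\<^sup>2 = 0" if "x \<notin> \<Omega>" for x
    proof -
      have "x \<notin> K" using that K(2) by blast
      then show ?thesis by (simp add: K(3,4))
    qed
  qed (use sq in simp)
  have "0 \<le> (LINT x|lebesgue_on \<Omega>. (deriv \<phi> x)\<^sup>2 - k\<^sup>2 * (\<phi> x)\<^sup>2)"
  proof (rule has_integral_le[OF 1 2])
    fix x
    have "(deriv \<phi> x)\<^sup>2 - k\<^sup>2 * (\<phi> x)\<^sup>2 - g x = (deriv \<phi> x - c (lft \<Omega> x) x * \<phi> x)\<^sup>2" if "x \<in> K"
      using that by (simp add: g_def power2_eq_square algebra_simps)
    then have "0 \<le> (deriv \<phi> x)\<^sup>2 - k\<^sup>2 * (\<phi> x)\<^sup>2 - g x" if "x \<in> K"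
      using that by simp
    then show "g x \<le> (deriv \<phi> x)\<^sup>2 - k\<^sup>2 * (\<phi> x)\<^sup>2"
      by (cases "x \<in> K") (simp_all add: K(3,4) g_def)
  qed
  then show ?thesis using sq by (simp add: k_def)
qed

text \<open>Both sides are continuous along an approximating sequence of test functions, for which
  the inequality is known.\<close>

lemma Poincare_H10:
  assumes u: "u \<in> H10 \<Omega>" and L: "0 < L" "\<And>x. x \<in> \<Omega> \<Longrightarrow> rgt \<Omega> x - lft \<Omega> x \<le> L"
  shows "(pi / L)\<^sup>2 * (LINT x|lebesgue_on \<Omega>. (u x)\<^sup>2) \<le> (LINT x|lebesgue_on \<Omega>. (weak_deriv \<Omega> u x)\<^sup>2)"
proof -
  obtain \<phi> where \<phi>: "\<And>n. \<phi> n \<in> test_functions \<Omega>"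
    "(\<lambda>n. LINT x|lebesgue_on \<Omega>. (\<phi> n x - u x)\<^sup>2) \<longlonglongrightarrow> 0"
    "(\<lambda>n. LINT x|lebesgue_on \<Omega>. (deriv (\<phi> n) x - weak_deriv \<Omega> u x)\<^sup>2) \<longlonglongrightarrow> 0"
    using H10E[OF u] by blast
  note t = test_functions_L2[OF \<phi>(1)]
  show ?thesis
  proof (rule LIMSEQ_le)
    show "(\<lambda>n. (pi / L)\<^sup>2 * (LINT x|lebesgue_on \<Omega>. (\<phi> n x)\<^sup>2)) \<longlonglongrightarrow> (pi / L)\<^sup>2 * (LINT x|lebesgue_on \<Omega>. (u x)\<^sup>2)"
      by (intro tendsto_mult tendsto_const L2_tendsto_square[OF t(1) H10_props(1)[OF u] \<phi>(2)])
    show "(\<lambda>n. LINT x|lebesgue_on \<Omega>. (deriv (\<phi> n) x)\<^sup>2) \<longlonglongrightarrow> (LINT x|lebesgue_on \<Omega>. (weak_deriv \<Omega> u x)\<^sup>2)"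
      by (rule L2_tendsto_square[OF t(2) H10_props(2)[OF u] \<phi>(3)])
  qed (use Poincare_test_functions[OF \<phi>(1) L] in auto)
qed

section \<open>The torsion function\<close>

lemma torsion_profile_H10:
  "torsion_profile \<Omega> \<in> H10 \<Omega>" "deriv (torsion_profile \<Omega>) \<in> L2 \<Omega>"
  "AE x in lebesgue_on \<Omega>. weak_deriv \<Omega> (torsion_profile \<Omega>) x = deriv (torsion_profile \<Omega>) x"
proof -
  have b: "\<bar>torsion_profile \<Omega> x\<bar> \<le> max m (m\<^sup>2)"
    "x \<in> \<Omega> \<Longrightarrow> \<bar>deriv (torsion_profile \<Omega>) x\<bar> \<le> max m (m\<^sup>2)" for x
    using abs_torsion_profile_le[of x] abs_deriv_torsion_profile_le[of x] by (auto simp: le_max_iff_disj)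
  note H = H10I[OF continuous_torsion_profile Ck_torsion_profile _ torsion_profile_nonneg
      compact_torsion_profile_ge b]
  show "torsion_profile \<Omega> \<in> H10 \<Omega>" "deriv (torsion_profile \<Omega>) \<in> L2 \<Omega>"
    "AE x in lebesgue_on \<Omega>. weak_deriv \<Omega> (torsion_profile \<Omega>) x = deriv (torsion_profile \<Omega>) x"
    by (rule H; simp add: torsion_profile_def)+
qed

text \<open>On every component w'' = -1, so the derivative of w' \<phi> is w' \<phi>' - \<phi>; its
  integral over the line is 0.\<close>

lemma torsion_profile_test:
  assumes \<phi>: "\<phi> \<in> test_functions \<Omega>"
  shows "(LINT x|lebesgue_on \<Omega>. deriv (torsion_profile \<Omega>) x * deriv \<phi> x) = (LINT x|lebesgue_on \<Omega>. \<phi> x)"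
proof -
  define w' where "w' = (\<lambda>x. (lft \<Omega> x + rgt \<Omega> x) / 2 - x)"
  have w': "deriv (torsion_profile \<Omega>) x = w' x" if "x \<in> \<Omega>" for x
    using torsion_profile_DERIV[OF that] by (simp add: w'_def DERIV_imp_deriv)
  obtain K where K: "compact K" "K \<subseteq> \<Omega>" "\<And>x. x \<notin> K \<Longrightarrow> \<phi> x = 0" "\<And>x. x \<notin> K \<Longrightarrow> deriv \<phi> x = 0"
    using test_functions_support[OF \<phi>] by metis
  have D: "((\<lambda>x. w' x * \<phi> x) has_real_derivative (w' x * deriv \<phi> x - \<phi> x)) (at x)" for x
  proof (cases "x \<in> K")
    case True
    then have x: "x \<in> \<Omega>" using K(2) by blast
    have "((\<lambda>y. ((lft \<Omega> x + rgt \<Omega> x) / 2 - y) * \<phi> y) has_real_derivative (w' x * deriv \<phi> x - \<phi> x)) (at x)"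
      by (auto intro!: derivative_eq_intros test_functions_DERIV[OF \<phi>] simp: w'_def)
    then show ?thesis
    proof (rule has_field_derivative_transform_within_open[where S = "{lft \<Omega> x<..<rgt \<Omega> x}"])
      show "((lft \<Omega> x + rgt \<Omega> x) / 2 - y) * \<phi> y = w' y * \<phi> y" if "y \<in> {lft \<Omega> x<..<rgt \<Omega> x}" for y
        using component_same[OF x, of y] that by (simp add: w'_def)
    qed (use component_bounds[OF x] in auto)
  next
    case False
    then show ?thesis
      using DERIV_zero_off_closed[OF compact_imp_closed[OF K(1)], of "\<lambda>x. w' x * \<phi> x"] K(3,4) by simp
  qed
  have int: "integrable (lebesgue_on \<Omega>) (\<lambda>x. deriv (torsion_profile \<Omega>) x * deriv \<phi> x)"
    "integrable (lebesgue_on \<Omega>) \<phi>"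
    using L2_integrable_mult[OF torsion_profile_H10(2) test_functions_L2(2)[OF \<phi>]]
      L2_integrable[OF test_functions_L2(1)[OF \<phi>]] by auto
  have "((\<lambda>x. w' x * deriv \<phi> x - \<phi> x) has_integral 0) UNIV"
    by (rule has_integral_deriv_compact_support[OF D K(1)]) (simp add: K(3))
  moreover have "((\<lambda>x. w' x * deriv \<phi> x - \<phi> x) has_integral
      (LINT x|lebesgue_on \<Omega>. w' x * deriv \<phi> x - \<phi> x)) UNIV"
  proof (rule lint_eq_has_integral)
    show "w' x * deriv \<phi> x - \<phi> x = 0" if "x \<notin> \<Omega>" for x
    proof -
      have "x \<notin> K" using that K(2) by blast
      then show ?thesis by (simp add: K(3,4))
    qed
    have "integrable (lebesgue_on \<Omega>) (\<lambda>x. deriv (torsion_profile \<Omega>) x * deriv \<phi> x - \<phi> x)"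
      using int by simp
    then show "integrable (lebesgue_on \<Omega>) (\<lambda>x. w' x * deriv \<phi> x - \<phi> x)"
      by (rule Bochner_Integration.integrable_cong[THEN iffD1, rotated 2]) (simp_all add: w')
  qed
  ultimately have "(LINT x|lebesgue_on \<Omega>. w' x * deriv \<phi> x - \<phi> x) = 0"
    by (rule has_integral_unique[symmetric])
  also have "(LINT x|lebesgue_on \<Omega>. w' x * deriv \<phi> x - \<phi> x)
      = (LINT x|lebesgue_on \<Omega>. deriv (torsion_profile \<Omega>) x * deriv \<phi> x - \<phi> x)"
    by (rule Bochner_Integration.integral_cong) (simp_all add: w')
  finally show ?thesis using int by simp
qed

lemma torsion_profile_weak_solution:
  assumes v: "v \<in> H10 \<Omega>"
  shows "(LINT x|lebesgue_on \<Omega>. weak_deriv \<Omega> (torsion_profile \<Omega>) x * weak_deriv \<Omega> v x)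
    = (LINT x|lebesgue_on \<Omega>. v x)"
proof -
  let ?w' = "deriv (torsion_profile \<Omega>)"
  obtain \<phi> where \<phi>: "\<And>n. \<phi> n \<in> test_functions \<Omega>"
    "(\<lambda>n. LINT x|lebesgue_on \<Omega>. (\<phi> n x - v x)\<^sup>2) \<longlonglongrightarrow> 0"
    "(\<lambda>n. LINT x|lebesgue_on \<Omega>. (deriv (\<phi> n) x - weak_deriv \<Omega> v x)\<^sup>2) \<longlonglongrightarrow> 0"
    using H10E[OF v] by blast
  note t = test_functions_L2[OF \<phi>(1)]
  have eq: "(LINT x|lebesgue_on \<Omega>. deriv (\<phi> n) x * ?w' x) = (LINT x|lebesgue_on \<Omega>. \<phi> n x * 1)" for n
    using torsion_profile_test[OF \<phi>(1)] by (simp add: mult.commute)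
  have "(\<lambda>n. LINT x|lebesgue_on \<Omega>. deriv (\<phi> n) x * ?w' x) \<longlonglongrightarrow> (LINT x|lebesgue_on \<Omega>. weak_deriv \<Omega> v x * ?w' x)"
    by (rule L2_tendsto_mult[OF t(2) H10_props(2)[OF v] torsion_profile_H10(2) \<phi>(3)])
  moreover have "(\<lambda>n. LINT x|lebesgue_on \<Omega>. deriv (\<phi> n) x * ?w' x) \<longlonglongrightarrow> (LINT x|lebesgue_on \<Omega>. v x * 1)"
    unfolding eq
    by (rule L2_tendsto_mult[OF t(1) H10_props(1)[OF v] const_L2 \<phi>(2)])
  ultimately have "(LINT x|lebesgue_on \<Omega>. weak_deriv \<Omega> v x * ?w' x) = (LINT x|lebesgue_on \<Omega>. v x * 1)"
    by (rule LIMSEQ_unique)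
  moreover have "(LINT x|lebesgue_on \<Omega>. weak_deriv \<Omega> (torsion_profile \<Omega>) x * weak_deriv \<Omega> v x)
      = (LINT x|lebesgue_on \<Omega>. weak_deriv \<Omega> v x * ?w' x)"
  proof (rule integral_cong_AE)
    show "(\<lambda>x. weak_deriv \<Omega> (torsion_profile \<Omega>) x * weak_deriv \<Omega> v x) \<in> borel_measurable (lebesgue_on \<Omega>)"
      "(\<lambda>x. weak_deriv \<Omega> v x * ?w' x) \<in> borel_measurable (lebesgue_on \<Omega>)"
      using L2_integrable_mult[OF H10_props(2)[OF torsion_profile_H10(1)] H10_props(2)[OF v]]
        L2_integrable_mult[OF H10_props(2)[OF v] torsion_profile_H10(2)] by auto
  qed (use torsion_profile_H10(3) in auto)
  ultimately show ?thesis by simp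
qed

text \<open>Testing each of two weak solutions with the other shows that both have integral equal to
  that of the product of their weak derivatives. Hence it suffices that the choice made by
  \<open>SOME\<close> is a solution.\<close>

lemma torsional_rigidity_eq: "torsional_rigidity \<Omega> = (LINT x|lebesgue_on \<Omega>. torsion_profile \<Omega> x)"
proof -
  let ?P = "\<lambda>w. w \<in> H10 \<Omega> \<and> (\<forall>v\<in>H10 \<Omega>.
     (LINT x|lebesgue_on \<Omega>. weak_deriv \<Omega> w x * weak_deriv \<Omega> v x) = (LINT x|lebesgue_on \<Omega>. v x))"
  let ?w = "torsion_profile \<Omega>" and ?t = "torsion_function \<Omega>"
  have w: "?P ?w" using torsion_profile_H10(1) torsion_profile_weak_solution by blast
  then have t: "?P ?t" unfolding torsion_function_def by (rule someI[of ?P])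
  have "torsional_rigidity \<Omega> = (LINT x|lebesgue_on \<Omega>. weak_deriv \<Omega> ?w x * weak_deriv \<Omega> ?t x)"
    using w t by (simp add: torsional_rigidity_def)
  also have "\<dots> = (LINT x|lebesgue_on \<Omega>. weak_deriv \<Omega> ?t x * weak_deriv \<Omega> ?w x)"
    by (simp add: mult.commute)
  also have "\<dots> = (LINT x|lebesgue_on \<Omega>. ?w x)" using w t by simp
  finally show ?thesis .
qed

section \<open>The first eigenvalue\<close>

lemma rayleigh_minimizer:
  assumes x0: "x0 \<in> \<Omega>"
  defines "k \<equiv> pi / (rgt \<Omega> x0 - lft \<Omega> x0)"
  obtains u where "u \<in> H10 \<Omega>" "\<not> (AE x in lebesgue_on \<Omega>. u x = 0)"
    "(LINT x|lebesgue_on \<Omega>. (weak_deriv \<Omega> u x)\<^sup>2) = k\<^sup>2 * (LINT x|lebesgue_on \<Omega>. (u x)\<^sup>2)"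
proof -
  define a b where "a = lft \<Omega> x0" and "b = rgt \<Omega> x0"
  have ab: "a < b" "{a<..<b} \<subseteq> \<Omega>" "a \<notin> \<Omega>" "b \<notin> \<Omega>"
    using component_bounds[OF x0] endpoints_notin[OF x0] by (auto simp: a_def b_def)
  have k: "k > 0" "k * (b - a) = pi" using ab by (simp_all add: k_def a_def b_def)
  \<comment> \<open>Clamping the argument to [a, b] makes the sine 0 outside, since k (b - a) =
    \<pi>, and keeps continuity evident.\<close>
  define u where "u = (\<lambda>x. sin (k * (max a (min b x) - a)))"
  have u_in: "u x = sin (k * (x - a))" if "x \<in> {a<..<b}" for x
    using that by (simp add: u_def)
  have u_out: "u x = 0" if "x \<notin> {a<..<b}" for x
    using that ab(1) k(2) by (cases "x \<le> a") (simp_all add: u_def)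
  have cont: "continuous_on UNIV u" unfolding u_def by (intro continuous_intros)
  have arg: "0 < k * (x - a)" "k * (x - a) < pi" if "x \<in> {a<..<b}" for x
  proof -
    show "0 < k * (x - a)" using that k by simp
    have "k * (x - a) < k * (b - a)" using that k(1) by (intro mult_strict_left_mono) auto
    then show "k * (x - a) < pi" unfolding k(2) .
  qed
  have u_pos: "0 < u x" if "x \<in> {a<..<b}" for x
    using u_in[OF that] arg[OF that] by (simp add: sin_gt_zero)
  have nonneg: "0 \<le> u x" for x
    using u_pos[of x] u_out[of x] by (cases "x \<in> {a<..<b}") auto
  \<comment> \<open>Every other component misses the arch, so \<open>u\<close> vanishes in a
    neighbourhood of each of its points. The corners of \<open>u\<close> at \<open>a\<close> and
    \<open>b\<close> lie off \<Omega>.\<close>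
  have other: "{lft \<Omega> x<..<rgt \<Omega> x} \<inter> {a<..<b} = {}" if x: "x \<in> \<Omega>" "x \<notin> {a<..<b}" for x
  proof (rule ccontr)
    assume "\<not> ?thesis"
    then obtain y where "y \<in> {lft \<Omega> x<..<rgt \<Omega> x}" "y \<in> {a<..<b}" by blast
    then have y: "lft \<Omega> x < y" "y < rgt \<Omega> x" "a < y" "y < b" by auto
    have "lft \<Omega> x = a" "rgt \<Omega> x = b"
      using component_same[OF x(1), of y] component_same[OF x0, of y] y by (auto simp: a_def b_def)
    with component_bounds[OF x(1)] x(2) show False by simp
  qed
  have smooth: "Ck n \<Omega> u" for n
  proof (rule Ck_local)
    fix x assume x: "x \<in> \<Omega>"
    show "\<exists>T. x \<in> T \<and> Ck n T u"
    proof (cases "x \<in> {a<..<b}")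
      case True
      have "Ck n {a<..<b} (\<lambda>x. k * (x + - a))" by (intro Ck_mult Ck_add) simp_all
      with Ck_compose[OF open_greaterThanLessThan UNIV_I conjunct1[OF Ck_sin_cos[OF open_UNIV]]]
      have "Ck n {a<..<b} (\<lambda>x. sin (k * (x + - a)))" .
      then have "Ck n {a<..<b} u"
        by (rule Ck_cong[OF open_greaterThanLessThan, rotated]) (simp add: u_in)
      with True show ?thesis by blast
    next
      case False
      have "Ck n {lft \<Omega> x<..<rgt \<Omega> x} (\<lambda>x. 0)" by simp
      then have "Ck n {lft \<Omega> x<..<rgt \<Omega> x} u"
        by (rule Ck_cong[OF open_greaterThanLessThan, rotated])
          (metis other[OF x False] u_out disjoint_iff)
      moreover have "x \<in> {lft \<Omega> x<..<rgt \<Omega> x}" using component_bounds[OF x] by simp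
      ultimately show ?thesis by blast
    qed
  qed
  have du_in: "deriv u x = k * cos (k * (x - a))" if "x \<in> {a<..<b}" for x
  proof -
    have "((\<lambda>x. sin (k * (x - a))) has_real_derivative k * cos (k * (x - a))) (at x)"
      by (auto intro!: derivative_eq_intros)
    then have "(u has_real_derivative k * cos (k * (x - a))) (at x)"
      by (rule has_field_derivative_transform_within_open[where S = "{a<..<b}"]) (use that u_in in auto)
    then show ?thesis by (rule DERIV_imp_deriv)
  qed
  have du_out: "deriv u x = 0" if x: "x \<in> \<Omega>" "x \<notin> {a<..<b}" for x
  proof -
    have "((\<lambda>_. 0) has_real_derivative 0) (at x)" by simp
    then have "(u has_real_derivative 0) (at x)"
    proof (rule has_field_derivative_transform_within_open[where S = "{lft \<Omega> x<..<rgt \<Omega> x}"])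
      show "0 = u y" if "y \<in> {lft \<Omega> x<..<rgt \<Omega> x}" for y
      proof -
        have "y \<notin> {a<..<b}" using other[OF x] that by blast
        then show ?thesis by (rule u_out[symmetric])
      qed
    qed (use component_bounds[OF x(1)] in auto)
    then show ?thesis by (rule DERIV_imp_deriv)
  qed
  have cpt: "compact {x. \<delta> \<le> u x}" if "0 < \<delta>" for \<delta>
  proof -
    have "{x. \<delta> \<le> u x} \<subseteq> {a<..<b}" using u_out that by (metis (mono_tags) mem_Collect_eq not_less subsetI)
    also have "\<dots> \<subseteq> {a..b}" by auto
    finally have "{x. \<delta> \<le> u x} \<subseteq> {a..b}" .
    moreover have "closed {x. \<delta> \<le> u x}" using cont by (intro closed_Collect_le) auto
    ultimately show ?thesis
      using bounded_subset[OF bounded_closed_interval] by (simp add: compact_eq_bounded_closed)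
  qed
  have bd: "\<bar>u x\<bar> \<le> max 1 k" for x
    by (simp add: u_def le_max_iff_disj)
  have bd': "\<bar>deriv u x\<bar> \<le> max 1 k" if "x \<in> \<Omega>" for x
  proof (cases "x \<in> {a<..<b}")
    case True
    then have "\<bar>deriv u x\<bar> \<le> k * 1"
      unfolding du_in[OF True] abs_mult using k by (intro mult_mono) auto
    then show ?thesis by simp
  qed (use du_out[OF that] in simp)
  note H = H10I[OF cont smooth _ nonneg cpt bd bd']
  have H10: "u \<in> H10 \<Omega>" and L2: "deriv u \<in> L2 \<Omega>"
    and AE: "AE x in lebesgue_on \<Omega>. weak_deriv \<Omega> u x = deriv u x"
    by (rule H; use u_out ab(2) in blast)+
  have "\<not> (AE x in lebesgue_on \<Omega>. u x = 0)"
  proof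
    assume "AE x in lebesgue_on \<Omega>. u x = 0"
    then have "AE x in lebesgue. x \<in> \<Omega> \<longrightarrow> u x = 0"
      using sets_Omega by (simp add: AE_restrict_space_iff)
    then have "AE x in lebesgue. x \<notin> {a<..<b}"
      by eventually_elim (use u_pos ab(2) in force)
    then have "{a<..<b} \<in> null_sets lebesgue"
      by (subst AE_iff_null_sets) auto
    then have "measure lebesgue {a<..<b} = 0" by (simp add: measure_def null_setsD1)
    with ab(1) show False by simp
  qed
  moreover have "(LINT x|lebesgue_on \<Omega>. (weak_deriv \<Omega> u x)\<^sup>2) = k\<^sup>2 * (LINT x|lebesgue_on \<Omega>. (u x)\<^sup>2)"
  proof -
    define g where "g = (\<lambda>x. if x \<in> {a<..<b} then (k * cos (k * (x - a)))\<^sup>2 - k\<^sup>2 * (sin (k * (x - a)))\<^sup>2 else 0)"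
    have int: "integrable (lebesgue_on \<Omega>) (\<lambda>x. (deriv u x)\<^sup>2)" "integrable (lebesgue_on \<Omega>) (\<lambda>x. (u x)\<^sup>2)"
      using L2_square_integrable[OF L2] L2_square_integrable[OF H10_props(1)[OF H10]] by auto
    have eq: "(deriv u x)\<^sup>2 - k\<^sup>2 * (u x)\<^sup>2 = g x" if "x \<in> \<Omega>" for x
      using that u_in[of x] u_out[of x] du_in[of x] du_out[of x] by (auto simp: g_def)
    have "integrable (lebesgue_on \<Omega>) (\<lambda>x. (deriv u x)\<^sup>2 - k\<^sup>2 * (u x)\<^sup>2)"
      using int by simp
    then have "integrable (lebesgue_on \<Omega>) g"
      by (rule Bochner_Integration.integrable_cong[THEN iffD1, rotated 2]) (simp_all add: eq)
    then have 1: "(g has_integral (LINT x|lebesgue_on \<Omega>. g x)) UNIV"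
      by (rule lint_eq_has_integral) (use ab(2) in \<open>auto simp: g_def\<close>)
    \<comment> \<open>The integrand is k^2 cos (2 k (x - a)), with antiderivative k sin cos; the
      sine vanishes at both ends. So the two integrals in the Rayleigh quotient differ exactly by
      the factor k^2.\<close>
    have "((\<lambda>x. (k * cos (k * (x - a)))\<^sup>2 - k\<^sup>2 * (sin (k * (x - a)))\<^sup>2) has_integral
        (k * sin (k * (b - a)) * cos (k * (b - a)) - k * sin (k * (a - a)) * cos (k * (a - a)))) {a..b}"
    proof (rule fundamental_theorem_of_calculus)
      fix x
      have "((\<lambda>x. k * sin (k * (x - a)) * cos (k * (x - a))) has_real_derivative
          ((k * cos (k * (x - a)))\<^sup>2 - k\<^sup>2 * (sin (k * (x - a)))\<^sup>2)) (at x within {a..b})"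
        by (auto intro!: derivative_eq_intros simp: power2_eq_square algebra_simps)
      then show "((\<lambda>x. k * sin (k * (x - a)) * cos (k * (x - a))) has_vector_derivative
          ((k * cos (k * (x - a)))\<^sup>2 - k\<^sup>2 * (sin (k * (x - a)))\<^sup>2)) (at x within {a..b})"
        by (simp add: has_real_derivative_iff_has_vector_derivative)
    qed (use ab(1) in simp)
    then have "((\<lambda>x. (k * cos (k * (x - a)))\<^sup>2 - k\<^sup>2 * (sin (k * (x - a)))\<^sup>2) has_integral 0) {a<..<b}"
      by (simp add: k(2) has_integral_Icc_iff_Ioo)
    then have "(g has_integral 0) UNIV"
      unfolding g_def by (simp only: has_integral_restrict_UNIV)
    then have "(LINT x|lebesgue_on \<Omega>. g x) = 0"
      by (rule has_integral_unique[OF 1])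
    moreover have "(LINT x|lebesgue_on \<Omega>. g x) = (LINT x|lebesgue_on \<Omega>. (deriv u x)\<^sup>2 - k\<^sup>2 * (u x)\<^sup>2)"
      by (rule Bochner_Integration.integral_cong) (simp_all add: eq)
    ultimately have "(LINT x|lebesgue_on \<Omega>. (deriv u x)\<^sup>2) = k\<^sup>2 * (LINT x|lebesgue_on \<Omega>. (u x)\<^sup>2)"
      using int by simp
    moreover have "(LINT x|lebesgue_on \<Omega>. (weak_deriv \<Omega> u x)\<^sup>2) = (LINT x|lebesgue_on \<Omega>. (deriv u x)\<^sup>2)"
    proof (rule integral_cong_AE)
      show "(\<lambda>x. (weak_deriv \<Omega> u x)\<^sup>2) \<in> borel_measurable (lebesgue_on \<Omega>)"
        using L2_square_integrable[OF H10_props(2)[OF H10]] by simp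
      show "(\<lambda>x. (deriv u x)\<^sup>2) \<in> borel_measurable (lebesgue_on \<Omega>)"
        using int by simp
    qed (use AE in auto)
    ultimately show ?thesis by simp
  qed
  ultimately show ?thesis using H10 that by blast
qed

text \<open>The Poincare inequality with the largest component length bounds every quotient from
  below, and the sine arch on a longest component attains the bound, as \<open>LEAST\<close>
  demands.\<close>

lemma dirichlet_eigenvalue_eq:
  assumes x0: "x0 \<in> \<Omega>" and max: "\<And>x. x \<in> \<Omega> \<Longrightarrow> rgt \<Omega> x - lft \<Omega> x \<le> rgt \<Omega> x0 - lft \<Omega> x0"
  shows "dirichlet_eigenvalue \<Omega> = (pi / (rgt \<Omega> x0 - lft \<Omega> x0))\<^sup>2"
proof -
  define L where "L = rgt \<Omega> x0 - lft \<Omega> x0"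
  have L: "0 < L" "\<And>x. x \<in> \<Omega> \<Longrightarrow> rgt \<Omega> x - lft \<Omega> x \<le> L"
    using component_bounds[OF x0] max by (auto simp: L_def)
  have pos: "0 < (LINT x|lebesgue_on \<Omega>. (u x)\<^sup>2)"
    if u: "u \<in> H10 \<Omega>" "\<not> (AE x in lebesgue_on \<Omega>. u x = 0)" for u
  proof -
    have "(LINT x|lebesgue_on \<Omega>. (u x)\<^sup>2) \<noteq> 0"
      using u(2) integral_nonneg_eq_0_iff_AE[OF L2_square_integrable[OF H10_props(1)[OF u(1)]]] by auto
    moreover have "0 \<le> (LINT x|lebesgue_on \<Omega>. (u x)\<^sup>2)"
      by (rule Bochner_Integration.integral_nonneg) simp
    ultimately show ?thesis by linarith
  qed
  obtain u where u: "u \<in> H10 \<Omega>" "\<not> (AE x in lebesgue_on \<Omega>. u x = 0)"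
    "(LINT x|lebesgue_on \<Omega>. (weak_deriv \<Omega> u x)\<^sup>2) = (pi / L)\<^sup>2 * (LINT x|lebesgue_on \<Omega>. (u x)\<^sup>2)"
    using rayleigh_minimizer[OF x0] unfolding L_def by blast
  show ?thesis
    unfolding dirichlet_eigenvalue_def L_def[symmetric]
  proof (rule Least_equality)
    show "\<exists>u\<in>H10 \<Omega>. \<not> (AE x in lebesgue_on \<Omega>. u x = 0) \<and> (pi / L)\<^sup>2 =
        (LINT x|lebesgue_on \<Omega>. (weak_deriv \<Omega> u x)\<^sup>2) / (LINT x|lebesgue_on \<Omega>. (u x)\<^sup>2)"
      using u pos[OF u(1,2)] by (intro bexI[of _ u]) auto
    fix l assume "\<exists>u\<in>H10 \<Omega>. \<not> (AE x in lebesgue_on \<Omega>. u x = 0) \<and> l =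
        (LINT x|lebesgue_on \<Omega>. (weak_deriv \<Omega> u x)\<^sup>2) / (LINT x|lebesgue_on \<Omega>. (u x)\<^sup>2)"
    then show "(pi / L)\<^sup>2 \<le> l"
      using Poincare_H10[OF _ L] pos by (force simp: pos_le_divide_eq)
  qed
qed

section \<open>Torsional rigidity as a sum of cubes\<close>

lemma integrable_torsion_profile: "integrable (lebesgue_on \<Omega>) (torsion_profile \<Omega>)"
  by (rule L2_integrable[OF H10_props(1)[OF torsion_profile_H10(1)]])

lemma lint_torsion_profile_interval:
  assumes ab: "a \<le> b" "{a<..<b} \<subseteq> \<Omega>" "a \<notin> \<Omega>" "b \<notin> \<Omega>"
  shows "(LINT x|lebesgue_on \<Omega>. torsion_profile \<Omega> x * indicator {a<..<b} x) = (b - a) ^ 3 / 12"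
proof -
  let ?f = "\<lambda>x. torsion_profile \<Omega> x * indicator {a<..<b} x"
  have m: "{a<..<b} \<in> sets (lebesgue_on \<Omega>)"
    using ab(2) by (auto simp: sets_restrict_space_iff sets_Omega)
  have 1: "(?f has_integral (LINT x|lebesgue_on \<Omega>. ?f x)) UNIV"
    by (rule lint_eq_has_integral[OF integrable_real_mult_indicator[OF m integrable_torsion_profile]])
      (simp add: torsion_profile_def)
  have "((\<lambda>x. (x - a) * (b - x) / 2) has_integral
      (((a + b) * b\<^sup>2 / 4 - b ^ 3 / 6 - a * b * b / 2) - ((a + b) * a\<^sup>2 / 4 - a ^ 3 / 6 - a * b * a / 2))) {a..b}"
  proof (rule fundamental_theorem_of_calculus[OF ab(1)])
    fix x
    have "((\<lambda>x. (a + b) * x\<^sup>2 / 4 - x ^ 3 / 6 - a * b * x / 2) has_real_derivative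
        (x - a) * (b - x) / 2) (at x within {a..b})"
      by (auto intro!: derivative_eq_intros simp: power2_eq_square field_simps)
    then show "((\<lambda>x. (a + b) * x\<^sup>2 / 4 - x ^ 3 / 6 - a * b * x / 2) has_vector_derivative
        (x - a) * (b - x) / 2) (at x within {a..b})"
      by (simp add: has_real_derivative_iff_has_vector_derivative)
  qed
  moreover have "((a + b) * b\<^sup>2 / 4 - b ^ 3 / 6 - a * b * b / 2) - ((a + b) * a\<^sup>2 / 4 - a ^ 3 / 6 - a * b * a / 2)
      = (b - a) ^ 3 / 12"
    by (simp add: field_simps power2_eq_square power3_eq_cube)
  ultimately have "((\<lambda>x. (x - a) * (b - x) / 2) has_integral (b - a) ^ 3 / 12) {a<..<b}"
    by (simp add: has_integral_Icc_iff_Ioo)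
  then have "((\<lambda>x. if x \<in> {a<..<b} then (x - a) * (b - x) / 2 else 0) has_integral (b - a) ^ 3 / 12) UNIV"
    by (simp only: has_integral_restrict_UNIV)
  moreover have "(\<lambda>x. if x \<in> {a<..<b} then (x - a) * (b - x) / 2 else 0) = ?f"
  proof
    fix x
    show "(if x \<in> {a<..<b} then (x - a) * (b - x) / 2 else 0) = ?f x"
      using component_unique[OF _ _ ab(2-4), of x] ab(2)
      by (cases "x \<in> {a<..<b}") (auto simp: torsion_profile_def)
  qed
  ultimately have "(?f has_integral (b - a) ^ 3 / 12) UNIV" by simp
  then show ?thesis by (rule has_integral_unique[OF 1])
qed

lemma lint_torsion_profile_UN:
  assumes "finite F" "disjoint_family_on (\<lambda>i. {a i<..<b i}) F"
    and "\<And>i. i \<in> F \<Longrightarrow> a i \<le> b i \<and> {a i<..<b i} \<subseteq> \<Omega> \<and> a i \<notin> \<Omega> \<and> b i \<notin> \<Omega>"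
  shows "(LINT x|lebesgue_on \<Omega>. torsion_profile \<Omega> x * indicator (\<Union>i\<in>F. {a i<..<b i}) x)
    = (\<Sum>i\<in>F. (b i - a i) ^ 3 / 12)"
proof -
  have "(LINT x|lebesgue_on \<Omega>. torsion_profile \<Omega> x * indicator (\<Union>i\<in>F. {a i<..<b i}) x)
      = (LINT x|lebesgue_on \<Omega>. (\<Sum>i\<in>F. torsion_profile \<Omega> x * indicator {a i<..<b i} x))"
    by (simp add: indicator_UN_disjoint[OF assms(1,2)] sum_distrib_left)
  also have "\<dots> = (\<Sum>i\<in>F. LINT x|lebesgue_on \<Omega>. torsion_profile \<Omega> x * indicator {a i<..<b i} x)"
  proof (rule Bochner_Integration.integral_sum)
    fix i assume "i \<in> F"
    then have "{a i<..<b i} \<in> sets (lebesgue_on \<Omega>)"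
      using assms(3) by (simp add: sets_restrict_space_iff sets_Omega)
    then show "integrable (lebesgue_on \<Omega>) (\<lambda>x. torsion_profile \<Omega> x * indicator {a i<..<b i} x)"
      by (rule integrable_real_mult_indicator[OF _ integrable_torsion_profile])
  qed
  also have "\<dots> = (\<Sum>i\<in>F. (b i - a i) ^ 3 / 12)"
    using assms(3) by (intro sum.cong) (simp_all add: lint_torsion_profile_interval)
  finally show ?thesis .
qed

lemma sum_lengths_le:
  assumes "finite F" "disjoint_family_on (\<lambda>i. {a i<..<b i}) F"
    and "\<And>i. i \<in> F \<Longrightarrow> a i \<le> b i \<and> {a i<..<b i} \<subseteq> \<Omega>"
  shows "(\<Sum>i\<in>F. b i - a i) \<le> m"
proof -
  have "measure lebesgue (\<Union>i\<in>F. {a i<..<b i}) = (\<Sum>i\<in>F. measure lebesgue {a i<..<b i})"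
    using assms by (intro measure_finite_Union) auto
  also have "\<dots> = (\<Sum>i\<in>F. b i - a i)" using assms(3) by (intro sum.cong) auto
  finally have "(\<Sum>i\<in>F. b i - a i) = measure lebesgue (\<Union>i\<in>F. {a i<..<b i})" by simp
  also have "\<dots> \<le> m"
    by (rule measure_mono_fmeasurable) (use assms lmeas_Omega in auto)
  finally show ?thesis .
qed

text \<open>The profile attains its maximum, being continuous with compact superlevel sets. On a
  component of length l its maximum is l^2 / 8, at the midpoint, so a global maximiser lies in a
  longest component.\<close>

lemma exists_longest_component:
  assumes "\<Omega> \<noteq> {}"
  obtains x0 where "x0 \<in> \<Omega>" "\<And>x. x \<in> \<Omega> \<Longrightarrow> rgt \<Omega> x - lft \<Omega> x \<le> rgt \<Omega> x0 - lft \<Omega> x0"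
proof -
  obtain z where z: "z \<in> \<Omega>" using assms by auto
  define \<epsilon> where "\<epsilon> = torsion_profile \<Omega> z"
  have \<epsilon>: "\<epsilon> > 0" using torsion_profile_pos[OF z] by (simp add: \<epsilon>_def)
  obtain x0 where x0: "\<epsilon> \<le> torsion_profile \<Omega> x0"
    "\<And>y. \<epsilon> \<le> torsion_profile \<Omega> y \<Longrightarrow> torsion_profile \<Omega> y \<le> torsion_profile \<Omega> x0"
    using continuous_attains_sup[OF compact_torsion_profile_ge[OF \<epsilon>] _
        continuous_on_subset[OF continuous_torsion_profile]] \<epsilon>_def by auto
  have max: "torsion_profile \<Omega> y \<le> torsion_profile \<Omega> x0" for y
    using x0 by (cases "\<epsilon> \<le> torsion_profile \<Omega> y") auto
  have x0\<Omega>: "x0 \<in> \<Omega>" using x0(1) \<epsilon> by (auto simp: torsion_profile_def split: if_splits)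
  have "rgt \<Omega> x - lft \<Omega> x \<le> rgt \<Omega> x0 - lft \<Omega> x0" if x: "x \<in> \<Omega>" for x
  proof -
    define l l0 where "l = rgt \<Omega> x - lft \<Omega> x" and "l0 = rgt \<Omega> x0 - lft \<Omega> x0"
    note b = component_bounds[OF x] component_bounds[OF x0\<Omega>]
    have "torsion_profile \<Omega> ((lft \<Omega> x + rgt \<Omega> x) / 2) = l\<^sup>2 / 8"
      using b by (subst torsion_profile_component[OF x]) (auto simp: l_def power2_eq_square field_simps)
    moreover have "torsion_profile \<Omega> x0 \<le> l0\<^sup>2 / 8"
    proof -
      have "0 \<le> (2 * x0 - lft \<Omega> x0 - rgt \<Omega> x0)\<^sup>2" by simp
      then show ?thesis using x0\<Omega>
        by (simp add: torsion_profile_def l0_def power2_eq_square field_simps)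
    qed
    ultimately have "l\<^sup>2 \<le> l0\<^sup>2" using max[of "(lft \<Omega> x + rgt \<Omega> x) / 2"] by simp
    then show ?thesis using b power2_le_imp_le[of l l0] by (simp add: l_def l0_def)
  qed
  with x0\<Omega> that show ?thesis by blast
qed

lemma lint_torsion_profile_subset_le:
  assumes "A \<in> sets lebesgue" "A \<subseteq> \<Omega>"
  shows "(LINT x|lebesgue_on \<Omega>. torsion_profile \<Omega> x * indicator A x) \<le> (LINT x|lebesgue_on \<Omega>. torsion_profile \<Omega> x)"
proof (rule integral_mono)
  have "A \<in> sets (lebesgue_on \<Omega>)" using assms by (simp add: sets_restrict_space_iff sets_Omega)
  then show "integrable (lebesgue_on \<Omega>) (\<lambda>x. torsion_profile \<Omega> x * indicator A x)"
    by (rule integrable_real_mult_indicator[OF _ integrable_torsion_profile])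
qed (auto simp: integrable_torsion_profile indicator_def torsion_profile_nonneg)

text \<open>The superlevel sets of the profile are compact, so finitely many components carry all of
  the torsional rigidity up to \<open>\<epsilon> |\<Omega>|\<close>; this replaces the sum over all components.\<close>

lemma torsion_finite_approx:
  assumes "\<epsilon> > 0"
  obtains F where "finite F" "disjoint_family_on (\<lambda>i. {fst i<..<snd i}) F"
    "\<And>i. i \<in> F \<Longrightarrow> \<exists>x\<in>\<Omega>. i = (lft \<Omega> x, rgt \<Omega> x)"
    "(LINT x|lebesgue_on \<Omega>. torsion_profile \<Omega> x) \<le> (\<Sum>i\<in>F. (snd i - fst i) ^ 3 / 12) + \<epsilon> * m"
proof -
  let ?K = "{x. \<epsilon> \<le> torsion_profile \<Omega> x}"
  let ?C = "\<lambda>x. {lft \<Omega> x<..<rgt \<Omega> x}"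
  have "?K \<subseteq> \<Omega>" using assms by (auto simp: torsion_profile_def split: if_splits)
  then have "?K \<subseteq> (\<Union>x\<in>\<Omega>. ?C x)" using component_bounds by fastforce
  then obtain X where X: "X \<subseteq> \<Omega>" "finite X" "?K \<subseteq> (\<Union>x\<in>X. ?C x)"
    using compactE_image[OF compact_torsion_profile_ge[OF assms], of \<Omega> ?C] by auto
  \<comment> \<open>Several points of \<open>X\<close> may lie in one component; passing to the set
    of endpoint pairs removes the repetitions, so that the intervals are disjoint.\<close>
  define F where "F = (\<lambda>x. (lft \<Omega> x, rgt \<Omega> x)) ` X"
  have F: "finite F" "\<And>i. i \<in> F \<Longrightarrow> \<exists>x\<in>\<Omega>. i = (lft \<Omega> x, rgt \<Omega> x)"
    using X by (auto simp: F_def)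
  have UN: "(\<Union>i\<in>F. {fst i<..<snd i}) = (\<Union>x\<in>X. ?C x)" by (auto simp: F_def)
  have disj: "disjoint_family_on (\<lambda>i. {fst i<..<snd i}) F"
    unfolding disjoint_family_on_def
  proof (intro ballI impI)
    fix i j assume ij: "i \<in> F" "j \<in> F" "i \<noteq> j"
    obtain x y where xy: "x \<in> \<Omega>" "y \<in> \<Omega>" "i = (lft \<Omega> x, rgt \<Omega> x)" "j = (lft \<Omega> y, rgt \<Omega> y)"
      using F(2) ij by metis
    have False if "z \<in> ?C x" "z \<in> ?C y" for z
      using component_same[OF xy(1), of z] component_same[OF xy(2), of z] that xy(3,4) ij(3) by simp
    then show "{fst i<..<snd i} \<inter> {fst j<..<snd j} = {}" unfolding xy(3,4) fst_conv snd_conv by blast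
  qed
  have Fi: "fst i \<le> snd i \<and> {fst i<..<snd i} \<subseteq> \<Omega> \<and> fst i \<notin> \<Omega> \<and> snd i \<notin> \<Omega>" if "i \<in> F" for i
  proof -
    obtain x where "x \<in> \<Omega>" "i = (lft \<Omega> x, rgt \<Omega> x)" using F(2)[OF \<open>i \<in> F\<close>] by auto
    then show ?thesis using component_bounds[of x] endpoints_notin[of x] by auto
  qed
  define A where "A = (\<Union>i\<in>F. {fst i<..<snd i})"
  have A: "A \<subseteq> \<Omega>" "open A" using Fi by (auto simp: A_def)
  have Am: "A \<in> sets (lebesgue_on \<Omega>)" using A by (simp add: sets_restrict_space_iff sets_Omega)
  have iA: "integrable (lebesgue_on \<Omega>) (\<lambda>x. torsion_profile \<Omega> x * indicator A x)"
    by (rule integrable_real_mult_indicator[OF Am integrable_torsion_profile])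
  have ic: "integrable (lebesgue_on \<Omega>) (\<lambda>x. \<epsilon>)" using L2_integrable[OF const_L2] .
  have "(LINT x|lebesgue_on \<Omega>. torsion_profile \<Omega> x) \<le> (LINT x|lebesgue_on \<Omega>. torsion_profile \<Omega> x * indicator A x + \<epsilon>)"
  proof (rule integral_mono[OF integrable_torsion_profile])
    fix x
    have "torsion_profile \<Omega> x \<le> \<epsilon>" if "x \<notin> A"
    proof -
      have "x \<notin> ?K" using that X(3) unfolding A_def UN by blast
      then show ?thesis by simp
    qed
    then show "torsion_profile \<Omega> x \<le> torsion_profile \<Omega> x * indicator A x + \<epsilon>"
      using assms by (cases "x \<in> A") auto
  qed (use iA ic in simp)
  also have "\<dots> = (LINT x|lebesgue_on \<Omega>. torsion_profile \<Omega> x * indicator A x) + \<epsilon> * m"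
    using iA ic by (simp add: measure_restrict_space sets_Omega mult.commute)
  also have "(LINT x|lebesgue_on \<Omega>. torsion_profile \<Omega> x * indicator A x) = (\<Sum>i\<in>F. (snd i - fst i) ^ 3 / 12)"
    unfolding A_def by (rule lint_torsion_profile_UN[OF F(1) disj Fi])
  finally show ?thesis using F disj that by blast
qed

end

subsection \<open>The diagram\<close>

text \<open>The largest sum of cubes of numbers in [0, 1] with sum \<open>s\<close> (for
  \<open>s\<close> at least 0): as many ones as fit, and one remainder.\<close>

definition cubic_floor :: "real \<Rightarrow> real" where
  "cubic_floor s = of_int \<lfloor>s\<rfloor> + (s - of_int \<lfloor>s\<rfloor>) ^ 3"

lemma cubic_floor_bounds: "of_int \<lfloor>s\<rfloor> \<le> cubic_floor s" "cubic_floor s \<le> of_int \<lfloor>s\<rfloor> + 1"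
proof -
  have "0 \<le> s - of_int \<lfloor>s\<rfloor>" "s - of_int \<lfloor>s\<rfloor> \<le> 1" by linarith+
  then show "of_int \<lfloor>s\<rfloor> \<le> cubic_floor s" "cubic_floor s \<le> of_int \<lfloor>s\<rfloor> + 1"
    by (simp_all add: cubic_floor_def power_le_one)
qed

lemma cubic_floor_mono:
  assumes "s \<le> t"
  shows "cubic_floor s \<le> cubic_floor t"
proof (cases "\<lfloor>s\<rfloor> = \<lfloor>t\<rfloor>")
  case True
  then show ?thesis
    unfolding cubic_floor_def True[symmetric] using assms by (intro add_mono power_mono) auto
next
  case False
  then have "\<lfloor>s\<rfloor> + 1 \<le> \<lfloor>t\<rfloor>" using floor_mono[OF assms] by linarith
  then have "of_int \<lfloor>s\<rfloor> + 1 \<le> (of_int \<lfloor>t\<rfloor> :: real)" by linarith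
  then show ?thesis using cubic_floor_bounds[of s] cubic_floor_bounds[of t] by linarith
qed

text \<open>Let f be the fractional part of \<open>s\<close>. If f + t < 1, the claim is that (f +
  t)^3 is at least f^3 + t^3. Otherwise the floor rises by 1 and the excess is 3 (f + t) (1 - f) (1
  - t), again nonnegative.\<close>

lemma cubic_floor_add_cube:
  assumes t: "0 \<le> t" "t \<le> 1"
  shows "cubic_floor s + t ^ 3 \<le> cubic_floor (s + t)"
proof -
  define f where "f = s - of_int \<lfloor>s\<rfloor>"
  have f: "0 \<le> f" "f < 1" unfolding f_def by linarith+
  have s: "cubic_floor s = of_int \<lfloor>s\<rfloor> + f ^ 3" by (simp add: cubic_floor_def f_def)
  show ?thesis
  proof (cases "f + t < 1")
    case True
    then have fl: "\<lfloor>s + t\<rfloor> = \<lfloor>s\<rfloor>" using t unfolding f_def by linarith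
    have "cubic_floor (s + t) = of_int \<lfloor>s\<rfloor> + (f + t) ^ 3"
      unfolding cubic_floor_def fl by (simp add: f_def algebra_simps)
    moreover have "(f + t) ^ 3 = f ^ 3 + t ^ 3 + 3 * f * t * (f + t)"
      by (simp add: power3_eq_cube algebra_simps)
    moreover have "0 \<le> 3 * f * t * (f + t)" using f t by simp
    ultimately show ?thesis using s by simp
  next
    case False
    then have fl: "\<lfloor>s + t\<rfloor> = \<lfloor>s\<rfloor> + 1" using t f unfolding f_def by linarith
    have "cubic_floor (s + t) = of_int \<lfloor>s\<rfloor> + 1 + (f + t - 1) ^ 3"
      unfolding cubic_floor_def fl by (simp add: f_def algebra_simps)
    moreover have "1 + (f + t - 1) ^ 3 = f ^ 3 + t ^ 3 + 3 * (f + t) * (1 - f) * (1 - t)"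
      by (simp add: power3_eq_cube algebra_simps)
    moreover have "0 \<le> 3 * (f + t) * (1 - f) * (1 - t)" using f t by simp
    ultimately show ?thesis using s by simp
  qed
qed

lemma sum_cubes_le_cubic_floor:
  assumes "finite F" "\<And>i. i \<in> F \<Longrightarrow> 0 \<le> l i \<and> l i \<le> 1"
  shows "(\<Sum>i\<in>F. l i ^ 3) \<le> cubic_floor (\<Sum>i\<in>F. l i)"
  using assms
proof (induction F rule: finite_induct)
  case (insert i F)
  then have "(\<Sum>j\<in>insert i F. l j ^ 3) \<le> cubic_floor (\<Sum>j\<in>F. l j) + l i ^ 3" by simp
  also have "\<dots> \<le> cubic_floor ((\<Sum>j\<in>F. l j) + l i)"
    using insert.prems by (intro cubic_floor_add_cube) auto
  finally show ?case using insert by (simp add: add.commute)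
qed (simp add: cubic_floor_def)

lemma open_finite_B1: "open_finite B1"
  by unfold_locales auto

lemma B1_component: "lft B1 0 = - 1" "rgt B1 0 = 1"
  using open_finite.component_unique[OF open_finite_B1, of "- 1" 0 1] by auto

lemma dirichlet_eigenvalue_B1: "dirichlet_eigenvalue B1 = (pi / 2)\<^sup>2"
proof -
  interpret B: open_finite B1 by (rule open_finite_B1)
  have "rgt B1 x - lft B1 x \<le> rgt B1 0 - lft B1 0" if "x \<in> B1" for x
    using B.component_unique[of "- 1" x 1] that by (simp add: B1_component)
  then show ?thesis using B.dirichlet_eigenvalue_eq[of 0] by (simp add: B1_component)
qed

lemma torsional_rigidity_B1: "torsional_rigidity B1 = 2 / 3"
proof -
  interpret B: open_finite B1 by (rule open_finite_B1)
  have "torsional_rigidity B1 = (LINT x|lebesgue_on B1. torsion_profile B1 x * indicator {-1<..<1} x)"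
    unfolding B.torsional_rigidity_eq
    by (rule Bochner_Integration.integral_cong) (auto simp: torsion_profile_def)
  also have "\<dots> = (1 - (- 1)) ^ 3 / 12"
    by (rule B.lint_torsion_profile_interval) auto
  finally show ?thesis by simp
qed

context open_finite
begin

lemma measure_pos: "x \<in> \<Omega> \<Longrightarrow> 0 < m"
  using component_bounds[of x] component_length_le[of x] by linarith

lemma x_coord_eq:
  assumes "x0 \<in> \<Omega>" "\<And>x. x \<in> \<Omega> \<Longrightarrow> rgt \<Omega> x - lft \<Omega> x \<le> rgt \<Omega> x0 - lft \<Omega> x0"
  shows "x_coord \<Omega> = ((rgt \<Omega> x0 - lft \<Omega> x0) / m)\<^sup>2"
proof -
  have eig: "dirichlet_eigenvalue \<Omega> = (pi / (rgt \<Omega> x0 - lft \<Omega> x0))\<^sup>2"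
    by (rule dirichlet_eigenvalue_eq) (fact assms)+
  show ?thesis
    unfolding x_coord_def dirichlet_eigenvalue_B1 eig
    using component_bounds[OF assms(1)] measure_pos[OF assms(1)] by (simp add: power_divide field_simps)
qed

lemma y_coord_eq: "y_coord \<Omega> = 12 * (LINT x|lebesgue_on \<Omega>. torsion_profile \<Omega> x) / m ^ 3"
  by (simp add: y_coord_def torsional_rigidity_B1 torsional_rigidity_eq)

text \<open>Dividing the component lengths by the longest one puts them into [0, 1], with sum at
  most \<open>m / L\<close>; \<open>cubic_floor\<close> then bounds the sum of cubes of any finitely
  many of them.\<close>

lemma y_coord_upper:
  assumes x0: "x0 \<in> \<Omega>" and max: "\<And>x. x \<in> \<Omega> \<Longrightarrow> rgt \<Omega> x - lft \<Omega> x \<le> rgt \<Omega> x0 - lft \<Omega> x0"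
  defines "r \<equiv> (rgt \<Omega> x0 - lft \<Omega> x0) / m"
  shows "y_coord \<Omega> \<le> r ^ 3 * cubic_floor (1 / r)"
proof -
  define L where "L = rgt \<Omega> x0 - lft \<Omega> x0"
  have L: "0 < L" using component_bounds[OF x0] by (simp add: L_def)
  note m = measure_pos[OF x0]
  define T where "T = (LINT x|lebesgue_on \<Omega>. torsion_profile \<Omega> x)"
  have "12 * T \<le> L ^ 3 * cubic_floor (m / L) + e" if e: "e > 0" for e
  proof -
    \<comment> \<open>Chosen so that the error \<epsilon> \<open>m\<close> of the finite
      approximation, multiplied by 12, is e.\<close>
    define \<epsilon> where "\<epsilon> = e / (12 * m)"
    have "\<epsilon> > 0" using e m by (simp add: \<epsilon>_def)
    then obtain F where F: "finite F" "disjoint_family_on (\<lambda>i. {fst i<..<snd i}) F"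
      "\<And>i. i \<in> F \<Longrightarrow> \<exists>x\<in>\<Omega>. i = (lft \<Omega> x, rgt \<Omega> x)"
      "T \<le> (\<Sum>i\<in>F. (snd i - fst i) ^ 3 / 12) + \<epsilon> * m"
      unfolding T_def using torsion_finite_approx by blast
    have Fi: "fst i \<le> snd i \<and> {fst i<..<snd i} \<subseteq> \<Omega> \<and> snd i - fst i \<le> L" if "i \<in> F" for i
    proof -
      obtain x where "x \<in> \<Omega>" "i = (lft \<Omega> x, rgt \<Omega> x)" using F(3)[OF \<open>i \<in> F\<close>] by auto
      then show ?thesis using component_bounds[of x] max[of x] by (auto simp: L_def)
    qed
    have "12 * T \<le> (\<Sum>i\<in>F. (snd i - fst i) ^ 3) + e"
      using F(4) m by (simp add: \<epsilon>_def sum_divide_distrib[symmetric] field_simps)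
    also have "(\<Sum>i\<in>F. (snd i - fst i) ^ 3) = L ^ 3 * (\<Sum>i\<in>F. ((snd i - fst i) / L) ^ 3)"
      using L by (simp add: power_divide sum_divide_distrib[symmetric])
    also have "(\<Sum>i\<in>F. ((snd i - fst i) / L) ^ 3) \<le> cubic_floor (\<Sum>i\<in>F. (snd i - fst i) / L)"
      using Fi L by (intro sum_cubes_le_cubic_floor[OF F(1)]) simp
    also have "\<dots> \<le> cubic_floor (m / L)"
    proof (rule cubic_floor_mono)
      have "(\<Sum>i\<in>F. snd i - fst i) \<le> m" using Fi by (intro sum_lengths_le[OF F(1,2)]) auto
      then show "(\<Sum>i\<in>F. (snd i - fst i) / L) \<le> m / L"
        unfolding sum_divide_distrib[symmetric] using L by (simp add: divide_right_mono)
    qed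
    finally show ?thesis using L by simp
  qed
  then have "12 * T \<le> L ^ 3 * cubic_floor (m / L)" by (rule field_le_epsilon)
  then have "12 * T / m ^ 3 \<le> L ^ 3 * cubic_floor (m / L) / m ^ 3"
    using m by (simp add: divide_right_mono)
  then show ?thesis
    by (simp add: y_coord_eq T_def r_def L_def power_divide)
qed

text \<open>A single component already contributes the cube of its relative length. If that is
  everything, a point outside it would bring a second component with a positive cube; so \<Omega> is
  that one interval.\<close>

lemma y_coord_lower:
  assumes x0: "x0 \<in> \<Omega>"
  defines "r \<equiv> (rgt \<Omega> x0 - lft \<Omega> x0) / m"
  shows "r ^ 3 \<le> y_coord \<Omega>" and "y_coord \<Omega> = r ^ 3 \<Longrightarrow> r = 1"
proof -
  define L where "L = rgt \<Omega> x0 - lft \<Omega> x0"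
  let ?C = "\<lambda>x. {lft \<Omega> x<..<rgt \<Omega> x}"
  note m = measure_pos[OF x0]
  define T where "T = (LINT x|lebesgue_on \<Omega>. torsion_profile \<Omega> x)"
  define T where "T = (LINT x|lebesgue_on \<Omega>. torsion_profile \<Omega> x)"
  have comp: "lft \<Omega> x \<le> rgt \<Omega> x \<and> ?C x \<subseteq> \<Omega> \<and> lft \<Omega> x \<notin> \<Omega> \<and> rgt \<Omega> x \<notin> \<Omega>" if "x \<in> \<Omega>" for x
    using component_bounds[OF that] endpoints_notin[OF that] by simp
  have "L ^ 3 / 12 = (LINT x|lebesgue_on \<Omega>. torsion_profile \<Omega> x * indicator (?C x0) x)"
    using comp[OF x0] by (simp add: L_def lint_torsion_profile_interval)
  also have "\<dots> \<le> T"
    unfolding T_def using comp[OF x0] by (intro lint_torsion_profile_subset_le) auto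
  finally have "L ^ 3 / m ^ 3 \<le> 12 * T / m ^ 3" using m by (intro divide_right_mono) auto
  then show "r ^ 3 \<le> y_coord \<Omega>" by (simp add: y_coord_eq T_def r_def L_def power_divide)
  assume "y_coord \<Omega> = r ^ 3"
  then have T: "12 * T = L ^ 3" using m by (simp add: y_coord_eq T_def r_def L_def power_divide)
  have "\<Omega> = ?C x0"
  proof (rule ccontr)
    assume "\<Omega> \<noteq> ?C x0"
    then obtain z where z: "z \<in> \<Omega>" "z \<notin> ?C x0" using comp[OF x0] by blast
    have disj: "disjoint_family_on ?C {x0, z}"
    proof -
      have False if "y \<in> ?C x0" "y \<in> ?C z" for y
        using component_same[OF x0, of y] component_same[OF z(1), of y] that z(2) component_bounds[OF z(1)]
        by simp
      then have "?C x0 \<inter> ?C z = {}" by blast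
      then show ?thesis by (auto simp: disjoint_family_on_def)
    qed
    have "x0 \<noteq> z" using z(2) component_bounds[OF x0] by auto
    then have "L ^ 3 / 12 + (rgt \<Omega> z - lft \<Omega> z) ^ 3 / 12 = (\<Sum>i\<in>{x0, z}. (rgt \<Omega> i - lft \<Omega> i) ^ 3 / 12)"
      by (simp add: L_def)
    also have "\<dots> = (LINT x|lebesgue_on \<Omega>. torsion_profile \<Omega> x * indicator (\<Union>i\<in>{x0, z}. ?C i) x)"
      by (rule lint_torsion_profile_UN[OF _ disj, symmetric]) (use comp x0 z in blast)+
    also have "\<dots> \<le> T"
      unfolding T_def using comp[OF x0] comp[OF z(1)] by (intro lint_torsion_profile_subset_le) auto
    finally have "(rgt \<Omega> z - lft \<Omega> z) ^ 3 \<le> 0" using T by linarith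
    moreover have "0 < (rgt \<Omega> z - lft \<Omega> z) ^ 3" using component_bounds[OF z(1)] by simp
    ultimately show False by simp
  qed
  then have "m = measure lebesgue (?C x0)" by (rule arg_cong)
  also have "\<dots> = L" using component_bounds[OF x0] by (simp add: L_def)
  finally have "m = L" .
  then show "r = 1" using m by (simp add: r_def L_def)
qed

end

text \<open>Repeated values of \<open>S\<close> give empty intervals, so that one family covers any number of components.\<close>

lemma partition_coords:
  fixes S :: "nat \<Rightarrow> real"
  assumes S: "mono S" "S 0 = 0" "S M = 1" "M > 0" "0 < S 1"
    and max: "\<And>i. i < M \<Longrightarrow> S (Suc i) - S i \<le> S 1"
  defines "\<Omega> \<equiv> \<Union>i<M. {S i<..<S (Suc i)}"
  shows "open_finite \<Omega>" "\<Omega> \<noteq> {}" "x_coord \<Omega> = (S 1)\<^sup>2" "y_coord \<Omega> = (\<Sum>i<M. (S (Suc i) - S i) ^ 3)"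
proof -
  show of: "open_finite \<Omega>"
    unfolding \<Omega>_def by unfold_locales auto
  then interpret open_finite \<Omega> .
  \<comment> \<open>The breakpoints are left out of \<Omega>, so every nonempty interval between
    consecutive ones is a full component.\<close>
  have notin: "S j \<notin> \<Omega>" for j
  proof
    assume "S j \<in> \<Omega>"
    then obtain i where i: "S i < S j" "S j < S (Suc i)" by (auto simp: \<Omega>_def)
    have "i < j" "j < Suc i"
      using i monoD[OF S(1), of j i] monoD[OF S(1), of "Suc i" j] by (meson not_less)+
    then show False by simp
  qed
  have le: "S i \<le> S (Suc i)" for i using monoD[OF S(1)] by simp
  have sub: "{S i<..<S (Suc i)} \<subseteq> \<Omega>" if "i < M" for i using that by (auto simp: \<Omega>_def)
  have disj: "disjoint_family_on (\<lambda>i. {S i<..<S (Suc i)}) {..<M}"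
    unfolding disjoint_family_on_def
  proof (intro ballI impI)
    have *: "{S i<..<S (Suc i)} \<inter> {S j<..<S (Suc j)} = {}" if "i < j" for i j
      using monoD[OF S(1), of "Suc i" j] that by auto
    fix i j :: nat assume "i \<noteq> j"
    then show "{S i<..<S (Suc i)} \<inter> {S j<..<S (Suc j)} = {}"
      using *[of i j] *[of j i] by (cases "i < j") auto
  qed
  have m1: "m = 1"
  proof -
    have "m = (\<Sum>i<M. measure lebesgue {S i<..<S (Suc i)})"
      unfolding \<Omega>_def using disj le by (intro measure_finite_Union) (auto simp: emeasure_lborel_Ioo)
    also have "\<dots> = (\<Sum>i<M. S (Suc i) - S i)" using le by (intro sum.cong) auto
    also have "\<dots> = 1" using S(2,3) by (simp add: sum_lessThan_telescope)
    finally show ?thesis .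
  qed
  have comp: "lft \<Omega> x = S i" "rgt \<Omega> x = S (Suc i)" if "i < M" "x \<in> {S i<..<S (Suc i)}" for i x
    using component_unique[OF _ _ sub[OF that(1)] notin notin] that(2) by auto
  \<comment> \<open>The midpoint of the first interval, which is a longest one by the assumption
    \<open>max\<close>.\<close>
  have x0: "S 1 / 2 \<in> {S 0<..<S (Suc 0)}" using S(2,5) by simp
  then have x0\<Omega>: "S 1 / 2 \<in> \<Omega>" using sub[of 0] S(4) by blast
  then show "\<Omega> \<noteq> {}" by blast
  have len: "rgt \<Omega> (S 1 / 2) - lft \<Omega> (S 1 / 2) = S 1"
    using comp[OF S(4) x0] S(2) by simp
  have "rgt \<Omega> x - lft \<Omega> x \<le> rgt \<Omega> (S 1 / 2) - lft \<Omega> (S 1 / 2)" if x: "x \<in> \<Omega>" for x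
  proof -
    obtain i where "i < M" "x \<in> {S i<..<S (Suc i)}" using x by (auto simp: \<Omega>_def)
    then show ?thesis using comp[of i x] max[of i] len by simp
  qed
  then have "x_coord \<Omega> = ((rgt \<Omega> (S 1 / 2) - lft \<Omega> (S 1 / 2)) / m)\<^sup>2"
    by (rule x_coord_eq[OF x0\<Omega>])
  then show "x_coord \<Omega> = (S 1)\<^sup>2" unfolding len m1 by simp
  have "(LINT x|lebesgue_on \<Omega>. torsion_profile \<Omega> x)
      = (LINT x|lebesgue_on \<Omega>. torsion_profile \<Omega> x * indicator (\<Union>i<M. {S i<..<S (Suc i)}) x)"
    by (rule Bochner_Integration.integral_cong) (auto simp: torsion_profile_def \<Omega>_def[symmetric])
  also have "\<dots> = (\<Sum>i<M. (S (Suc i) - S i) ^ 3 / 12)"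
    by (rule lint_torsion_profile_UN[OF _ disj]) (use le sub notin in auto)
  finally show "y_coord \<Omega> = (\<Sum>i<M. (S (Suc i) - S i) ^ 3)"
    by (simp add: y_coord_eq m1 sum_divide_distrib[symmetric])
qed

section \<open>Realising the admissible points\<close>

text \<open>One interval of length \<open>l\<close> is followed by intervals of length t up to total
  length 1, the last one shorter. The sum of cubes depends continuously on t, is at most y for t =
  t0 and at least y for t = l; the intermediate value theorem gives t.\<close>

lemma partition_exists:
  assumes l: "0 < l" "l < 1" and y: "l ^ 3 < y" "y \<le> l ^ 3 * cubic_floor (1 / l)"
  shows "\<exists>\<Omega>. open_finite \<Omega> \<and> \<Omega> \<noteq> {} \<and> x_coord \<Omega> = l\<^sup>2 \<and> y_coord \<Omega> = y"
proof -
  \<comment> \<open>Pieces of length at most t0 and total length at most 1 have cubes summing to at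
    most t0^2, which must not exceed y - l^3; t0 is at most \<open>l\<close> so that the first
    interval remains a longest one.\<close>
  define t0 where "t0 = min l (sqrt (y - l ^ 3))"
  have t0: "0 < t0" "t0 \<le> l" using l y by (auto simp: t0_def)
  have t0sq: "t0\<^sup>2 \<le> y - l ^ 3"
  proof -
    have "t0\<^sup>2 \<le> (sqrt (y - l ^ 3))\<^sup>2" using t0(1) by (intro power_mono) (auto simp: t0_def)
    then show ?thesis using y by simp
  qed
  define n where "n = nat \<lfloor>1 / l\<rfloor>"
  have "\<lfloor>1 / l\<rfloor> \<ge> 1" using l by (simp add: field_simps)
  then have n: "n \<ge> 1" "real n = of_int \<lfloor>1 / l\<rfloor>" unfolding n_def by linarith+
  have nl: "real n * l \<le> 1" "1 < (real n + 1) * l"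
  proof -
    have "real n \<le> 1 / l" "1 / l < real n + 1" unfolding n(2) by linarith+
    then show "real n * l \<le> 1" "1 < (real n + 1) * l" using l by (simp_all add: field_simps)
  qed
  obtain N0 :: nat where "1 / t0 \<le> real N0" using real_arch_simple by blast
  then have N0: "1 \<le> real N0 * t0" using t0 by (simp add: field_simps)
  \<comment> \<open>\<open>N0\<close> steps suffice to reach 1 for every t from t0 on;
    \<open>n\<close> steps contain all pieces for t = l. A number of terms independent of t makes
    the continuity of \<open>Y\<close> evident.\<close>
  define N where "N = max N0 n"
  \<comment> \<open>The minimum with 1 shortens the last piece and makes all later intervals
    empty.\<close>
  define S where "S = (\<lambda>t i. case i of 0 \<Rightarrow> 0 | Suc j \<Rightarrow> min 1 (l + real j * t))"
  define Y where "Y = (\<lambda>t. l ^ 3 + (\<Sum>j<N. (min 1 (l + real (Suc j) * t) - min 1 (l + real j * t)) ^ 3))"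
  have step: "0 \<le> min 1 (l + real (Suc j) * t) - min 1 (l + real j * t)"
    "min 1 (l + real (Suc j) * t) - min 1 (l + real j * t) \<le> t" if "0 \<le> t" for t j
    using that by (auto simp: algebra_simps min_def)
  have mono: "mono (S t)" if "0 \<le> t" for t
  proof (rule incseq_SucI)
    show "S t i \<le> S t (Suc i)" for i
      using step(1)[OF that, of "i - 1"] l that by (cases i) (auto simp: S_def)
  qed
  have S1: "S t 1 = l" for t using l by (simp add: S_def)
  have SN: "S t (Suc N) = 1" if "t0 \<le> t" for t
  proof -
    have "real N0 * t0 \<le> real N * t" using that t0 by (intro mult_mono) (auto simp: N_def)
    then show ?thesis using N0 l by (simp add: S_def)
  qed
  have coords: "open_finite (\<Union>i<Suc N. {S t i<..<S t (Suc i)})" "(\<Union>i<Suc N. {S t i<..<S t (Suc i)}) \<noteq> {}"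
    "x_coord (\<Union>i<Suc N. {S t i<..<S t (Suc i)}) = l\<^sup>2" "y_coord (\<Union>i<Suc N. {S t i<..<S t (Suc i)}) = Y t"
    if t: "t0 \<le> t" "t \<le> l" for t
  proof -
    have t': "0 \<le> t" using t t0 by simp
    have S0: "S t 0 = 0" by (simp add: S_def)
    have "S t (Suc i) - S t i \<le> S t 1" for i
      using step(2)[OF t', of "i - 1"] t l by (cases i) (auto simp: S_def)
    note P = partition_coords[OF mono[OF t'] S0 SN[OF t(1)] _ _ this]
    show "open_finite (\<Union>i<Suc N. {S t i<..<S t (Suc i)})" "(\<Union>i<Suc N. {S t i<..<S t (Suc i)}) \<noteq> {}"
      "x_coord (\<Union>i<Suc N. {S t i<..<S t (Suc i)}) = l\<^sup>2"
      using P(1-3) l unfolding S1 by blast+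
    have "y_coord (\<Union>i<Suc N. {S t i<..<S t (Suc i)}) = (\<Sum>i<Suc N. (S t (Suc i) - S t i) ^ 3)"
      using P(4) l unfolding S1 by blast
    also have "\<dots> = Y t"
      unfolding sum.lessThan_Suc_shift using l by (simp add: S_def Y_def)
    finally show "y_coord (\<Union>i<Suc N. {S t i<..<S t (Suc i)}) = Y t" .
  qed
  have "Y t0 \<le> y"
  proof -
    have "(\<Sum>j<N. (min 1 (l + real (Suc j) * t0) - min 1 (l + real j * t0)) ^ 3)
        \<le> (\<Sum>j<N. t0\<^sup>2 * (min 1 (l + real (Suc j) * t0) - min 1 (l + real j * t0)))"
    proof (rule sum_mono)
      fix j
      define d where "d = min 1 (l + real (Suc j) * t0) - min 1 (l + real j * t0)"
      have d: "0 \<le> d" "d \<le> t0" using step[of t0 j] t0 by (simp_all add: d_def)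
      then have "d\<^sup>2 * d \<le> t0\<^sup>2 * d" by (intro mult_right_mono power_mono) auto
      then show "(min 1 (l + real (Suc j) * t0) - min 1 (l + real j * t0)) ^ 3
          \<le> t0\<^sup>2 * (min 1 (l + real (Suc j) * t0) - min 1 (l + real j * t0))"
        unfolding d_def[symmetric] by (simp add: power2_eq_square power3_eq_cube)
    qed
    also have "\<dots> = t0\<^sup>2 * (min 1 (l + real N * t0) - min 1 l)"
      unfolding sum_distrib_left[symmetric]
      using sum_lessThan_telescope[of "\<lambda>j. min 1 (l + real j * t0)" N] by simp
    also have "\<dots> \<le> t0\<^sup>2 * 1" using l by (intro mult_left_mono) auto
    finally show ?thesis using t0sq by (simp add: Y_def)
  qed
  moreover have "y \<le> Y l"
  proof -
    have Suc_n: "Suc (n - 1) = n" using n(1) by simp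
    have "cubic_floor (1 / l) = real n + (1 / l - real n) ^ 3"
      unfolding cubic_floor_def n(2) ..
    then have "y \<le> l ^ 3 * (real n + (1 / l - real n) ^ 3)" using y by simp
    also have "l ^ 3 * (real n + q ^ 3) = real n * l ^ 3 + (l * q) ^ 3" for q
      by (simp add: power_mult_distrib algebra_simps)
    also have "l * (1 / l - real n) = 1 - real n * l" using l by (simp add: field_simps)
    finally have y_le: "y \<le> real n * l ^ 3 + (1 - real n * l) ^ 3" .
    \<comment> \<open>Case t = l. The indices below n - 1 are full steps of length \<open>l\<close>,
      and the index n - 1 leads from n l to 1. Together with the first interval these are n
      intervals of length \<open>l\<close> and the remainder.\<close>
    have "(\<Sum>j<Suc (n - 1). (min 1 (l + real (Suc j) * l) - min 1 (l + real j * l)) ^ 3)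
        = (\<Sum>j<n - 1. (min 1 (l + real (Suc j) * l) - min 1 (l + real j * l)) ^ 3)
          + (min 1 (l + real (Suc (n - 1)) * l) - min 1 (l + real (n - 1) * l)) ^ 3"
      by (rule sum.lessThan_Suc)
    also have "(\<Sum>j<n - 1. (min 1 (l + real (Suc j) * l) - min 1 (l + real j * l)) ^ 3) = (\<Sum>j<n - 1. l ^ 3)"
    proof (rule sum.cong)
      fix j assume "j \<in> {..<n - 1}"
      then have "real j + 2 \<le> real n" by (simp add: of_nat_diff less_diff_conv)
      then have "(real j + 2) * l \<le> real n * l" using l by (intro mult_right_mono) auto
      then have "l + real (Suc j) * l \<le> 1" "l + real j * l \<le> 1" using nl l by (auto simp: algebra_simps)
      then show "(min 1 (l + real (Suc j) * l) - min 1 (l + real j * l)) ^ 3 = l ^ 3"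
        by (simp add: min_def algebra_simps)
    qed simp
    also have "min 1 (l + real (Suc (n - 1)) * l) - min 1 (l + real (n - 1) * l) = 1 - real n * l"
      using nl n(1) by (simp add: of_nat_diff algebra_simps)
    finally have "(\<Sum>j<n. (min 1 (l + real (Suc j) * l) - min 1 (l + real j * l)) ^ 3)
        = (real n - 1) * l ^ 3 + (1 - real n * l) ^ 3"
      using n(1) unfolding Suc_n by (simp add: of_nat_diff)
    moreover have "(\<Sum>j<n. (min 1 (l + real (Suc j) * l) - min 1 (l + real j * l)) ^ 3)
        \<le> (\<Sum>j<N. (min 1 (l + real (Suc j) * l) - min 1 (l + real j * l)) ^ 3)"
      using step(1)[of l] l by (intro sum_mono2) (auto simp: N_def)
    ultimately show ?thesis using y_le by (simp add: Y_def algebra_simps)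
  qed
  moreover have "continuous_on {t0..l} Y"
    unfolding Y_def by (intro continuous_intros)
  ultimately obtain t where "t0 \<le> t" "t \<le> l" "Y t = y"
    using IVT'[of Y t0 y l] t0(2) by blast
  then show ?thesis using coords[of t] by blast
qed

lemma powr_of_square:
  assumes "0 < (r :: real)"
  shows "(r\<^sup>2) powr (3/2) = r ^ 3" "(r\<^sup>2) powr (-1/2) = 1 / r"
proof -
  have eq: "(r\<^sup>2) powr a = r powr (2 * a)" for a
    using assms by (simp add: powr_powr flip: powr_numeral)
  show "(r\<^sup>2) powr (3/2) = r ^ 3" using assms by (simp add: eq powr_numeral)
  show "(r\<^sup>2) powr (-1/2) = 1 / r" using assms by (simp add: eq powr_minus_divide)
qed

text \<open>The last conjunct excludes the points of the lower curve with x < 1: there a longest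
  component does not fill \<Omega>, and any other component makes y strictly larger than its cube
  alone. At x = 1 both bounds are 1, attained by an interval.\<close>

theorem proposition7p1:
  fixes x y :: real
  assumes "0 < x" and "x \<le> 1"
  shows "(x, y) \<in> blaschke_santalo_diagram \<longleftrightarrow>
    x powr (3/2) \<le> y \<and>
    y \<le> x powr (3/2) * (of_int \<lfloor>x powr (-1/2)\<rfloor> + (x powr (-1/2) - of_int \<lfloor>x powr (-1/2)\<rfloor>) ^ 3) \<and>
    (y = x powr (3/2) \<longrightarrow> x = 1)"
proof -
  \<comment> \<open>The relative length of a longest component, since the first coordinate is its
    square.\<close>
  define l where "l = sqrt x"
  have l: "0 < l" "l \<le> 1" "x = l\<^sup>2" using assms by (auto simp: l_def)
  have diagram: "(x, y) \<in> blaschke_santalo_diagram \<longleftrightarrow>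
      (\<exists>\<Omega>. open_finite \<Omega> \<and> \<Omega> \<noteq> {} \<and> x_coord \<Omega> = x \<and> y_coord \<Omega> = y)"
  proof -
    have "open_finite \<Omega> \<and> \<Omega> \<noteq> {} \<longleftrightarrow> open \<Omega> \<and> 0 < emeasure lebesgue \<Omega> \<and> emeasure lebesgue \<Omega> < \<infinity>" for \<Omega>
    proof
      assume \<Omega>: "open_finite \<Omega> \<and> \<Omega> \<noteq> {}"
      then interpret open_finite \<Omega> by simp
      obtain z where "z \<in> \<Omega>" using \<Omega> by blast
      then have "0 < m" by (rule measure_pos)
      then show "open \<Omega> \<and> 0 < emeasure lebesgue \<Omega> \<and> emeasure lebesgue \<Omega> < \<infinity>"
        unfolding emeasure_eq_measure2[OF lmeas_Omega] using open_Omega by simp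
    next
      assume "open \<Omega> \<and> 0 < emeasure lebesgue \<Omega> \<and> emeasure lebesgue \<Omega> < \<infinity>"
      then show "open_finite \<Omega> \<and> \<Omega> \<noteq> {}"
        by (auto simp: open_finite_def fmeasurable_def)
    qed
    then show ?thesis unfolding blaschke_santalo_diagram_def by auto
  qed
  have "(x, y) \<in> blaschke_santalo_diagram \<longleftrightarrow>
      l ^ 3 \<le> y \<and> y \<le> l ^ 3 * cubic_floor (1 / l) \<and> (y = l ^ 3 \<longrightarrow> l = 1)"
  proof
    assume "(x, y) \<in> blaschke_santalo_diagram"
    then obtain \<Omega> where \<Omega>: "open_finite \<Omega>" "\<Omega> \<noteq> {}" "x_coord \<Omega> = x" "y_coord \<Omega> = y"
      unfolding diagram by blast
    interpret open_finite \<Omega> by fact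
    obtain x0 where x0: "x0 \<in> \<Omega>" "\<And>x. x \<in> \<Omega> \<Longrightarrow> rgt \<Omega> x - lft \<Omega> x \<le> rgt \<Omega> x0 - lft \<Omega> x0"
      using exists_longest_component[OF \<Omega>(2)] by blast
    have "l\<^sup>2 = ((rgt \<Omega> x0 - lft \<Omega> x0) / m)\<^sup>2"
      using x_coord_eq[OF x0] \<Omega>(3) l(3) by simp
    moreover have "0 < (rgt \<Omega> x0 - lft \<Omega> x0) / m"
      using component_bounds[OF x0(1)] measure_pos[OF x0(1)] by simp
    ultimately have r: "(rgt \<Omega> x0 - lft \<Omega> x0) / m = l"
      using l(1) power2_eq_imp_eq[of l "(rgt \<Omega> x0 - lft \<Omega> x0) / m"] by simp
    show "l ^ 3 \<le> y \<and> y \<le> l ^ 3 * cubic_floor (1 / l) \<and> (y = l ^ 3 \<longrightarrow> l = 1)"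
      using y_coord_lower[OF x0(1)] y_coord_upper[OF x0] unfolding r \<Omega>(4) by blast
  next
    assume y: "l ^ 3 \<le> y \<and> y \<le> l ^ 3 * cubic_floor (1 / l) \<and> (y = l ^ 3 \<longrightarrow> l = 1)"
    show "(x, y) \<in> blaschke_santalo_diagram"
    proof (cases "l = 1")
      case True
      then have "y = 1" using y by (simp add: cubic_floor_def)
      \<comment> \<open>Breakpoints 0, 1, 1, ...: the set is the unit interval.\<close>
      let ?S = "\<lambda>i. real (min i 1)"
      have S: "mono ?S" "?S 0 = 0" "?S 1 = 1" "0 < (1 :: nat)" "0 < ?S 1"
        by (simp_all add: mono_def min.coboundedI1)
      have P: "open_finite (\<Union>i<1. {?S i<..<?S (Suc i)})" "(\<Union>i<1. {?S i<..<?S (Suc i)}) \<noteq> {}"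
        "x_coord (\<Union>i<1. {?S i<..<?S (Suc i)}) = (?S 1)\<^sup>2"
        "y_coord (\<Union>i<1. {?S i<..<?S (Suc i)}) = (\<Sum>i<1. (?S (Suc i) - ?S i) ^ 3)"
        by (rule partition_coords[OF S], simp)+
      have "(?S 1)\<^sup>2 = x" "(\<Sum>i<1. (?S (Suc i) - ?S i) ^ 3) = y"
        using True l(3) \<open>y = 1\<close> by simp_all
      with P show ?thesis unfolding diagram by metis
    next
      case False
      then have "l < 1" "l ^ 3 < y" using l(2) y by auto
      then have "\<exists>\<Omega>. open_finite \<Omega> \<and> \<Omega> \<noteq> {} \<and> x_coord \<Omega> = l\<^sup>2 \<and> y_coord \<Omega> = y"
        using y by (intro partition_exists l(1)) simp_all
      then show ?thesis unfolding diagram unfolding l(3) .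
    qed
  qed
  moreover have "l = 1 \<longleftrightarrow> x = 1" by (simp add: l_def)
  moreover have "x powr (3/2) = l ^ 3" "x powr (-1/2) = 1 / l"
    using powr_of_square[OF l(1)] unfolding l(3)[symmetric] by simp_all
  ultimately show ?thesis unfolding cubic_floor_def by metis
qed

end
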